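(* Let $p$ be a prime, $q$ a power of $p$, $\mathcal{P}_1$ the set of monic irreducible polynomials in $\mathbb{F}_q[T]$, and let $k=(q-1)\ell$ with $\ell$ a positive integer. If $1 \leq \ell \leq q/p$, then \[ \sum_{P \in \mathcal{P}_1} G_p(1/P^k) = 0. \] If $q/p + 1 < \ell \leq 2q/p$, then \[ \sum_{P \in \mathcal{P}_1} G_p(1/P^k) = \ell \, \frac{(T^q-T)^{q+1}}{(T^{q^2}-T^q)(T^{q^2}-T)}, \] where $\ell$ is regarded as an element of $\mathbb{F}_p \subseteq \mathbb{F}_q$.
   Context: $G_p(U) \in \mathbb{F}_p(U)$ is the rational function $\dfrac{(1-U^p)-(1-U)^p}{p\,(1-U)^p}$, where the numerator polynomial in $\mathbb{Z}[U]$ is divided by $p$ in $\mathbb{Z}[U]$ before reducing modulo $p$. The sums are taken in $\widehat{\mathcal{K}} = \mathbb{F}_q((T^{-1}))$, the $T^{-1}$-adic completion of $\mathbb{F}_q(T)$, with $G_p(1/P^k)$ obtained by substituting $U=1/P^k$. *)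

theory Defs
  imports "HOL-Analysis.Analysis" "HOL-Computational_Algebra.Primes"
    "HOL-Computational_Algebra.Formal_Laurent_Series"
begin

text \<open>
  The field \<open>\<bbbF>\<^sub>q\<close> is a type of classes \<open>field\<close> and \<open>finite\<close>. The completion
  \<open>\<bbbF>\<^sub>q((T\<^sup>-\<^sup>1))\<close> is the type of formal Laurent series over it, whose
  indeterminate \<open>fls_X\<close> plays the role of \<open>T\<^sup>-\<^sup>1\<close>, so that \<open>T\<close> is
  \<open>fls_X_inv\<close>; the metric topology of the library on \<open>fls\<close> is then the
  \<open>T\<^sup>-\<^sup>1\<close>-adic one.
\<close>

abbreviation T_fls :: "'a::field fls" where
  "T_fls \<equiv> fls_X_inv"

definition poly_to_fls :: "'a::field poly \<Rightarrow> 'a fls" where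
  "poly_to_fls P = poly (map_poly fls_const P) T_fls"

definition monic_irreducibles :: "'a::field poly set" where
  "monic_irreducibles = {P. lead_coeff P = 1 \<and> irreducible P}"

definition G_numerator :: "nat \<Rightarrow> int poly" where
  "G_numerator p = ((1 - monom 1 p) - (1 - monom 1 1) ^ p) div [:int p:]"

text \<open>The division by \<open>p\<close> above is exact.\<close>

lemma G_numerator_exact:
  assumes "prime p"
  shows "smult (int p) (G_numerator p) = (1 - monom 1 p) - (1 - monom 1 1) ^ p"
proof -
  have p: "p > 1" using assms by (rule prime_gt_1_nat)
  have lin: "1 - monom 1 1 = [:1, -1 :: int:]"
    by (simp add: monom_altdef one_pCons)
  have "int p dvd coeff ((1 - monom 1 p) - [:1, -1:] ^ p) i" for i
  proof -
    consider "i = 0" | "i = p" | "0 < i" "i < p" | "i > p" by linarith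
    then show ?thesis
    proof cases
      case 1
      then show ?thesis using p by (simp add: coeff_linear_poly_power)
    next
      case 2
      then show ?thesis using p assms prime_odd_nat[of p]
        by (cases "p = 2") (auto simp: coeff_linear_poly_power)
    next
      case 3
      then have "p dvd (p choose i)"
        using assms by (intro dvd_choose_prime) auto
      then show ?thesis using 3 by (simp add: coeff_linear_poly_power)
    next
      case 4
      have "degree ([:1, -1 :: int:] ^ p) = p" by (simp add: degree_power_eq)
      then show ?thesis using 4 p by (simp add: coeff_eq_0)
    qed
  qed
  then have "[:int p:] dvd (1 - monom 1 p) - [:1, -1:] ^ p"
    by (simp add: const_poly_dvd_iff)
  then have "[:int p:] * G_numerator p = (1 - monom 1 p) - [:1, -1:] ^ p"
    unfolding G_numerator_def lin by (rule dvd_mult_div_cancel)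
  then show ?thesis unfolding lin by simp
qed

text \<open>
  The value \<open>G\<^sub>p(u)\<close> for \<open>u\<close> in an extension field of \<open>\<bbbF>\<^sub>p\<close>. In characteristic
  \<open>p\<close>, \<open>of_int\<close> is reduction modulo \<open>p\<close> of the coefficients. The definition is
  meaningful for \<open>u \<noteq> 1\<close>.
\<close>

definition G :: "nat \<Rightarrow> 'b::field \<Rightarrow> 'b" where
  "G p u = poly (map_poly of_int (G_numerator p)) u / (1 - u) ^ p"

end

theory Submission
  imports Defs "HOL-Library.Poly_Mapping" "HOL-Library.Multiset"
    "HOL-Computational_Algebra.Computational_Algebra"
begin

text \<open>
  The integer polynomial \<open>carry\<close>, which is \<open>((\<Sum>x)\<^sup>p - \<Sum>x\<^sup>p) / p\<close>, turns products of
  families into sums: modulo \<open>p\<close>, \<open>carry / (\<Sum>x)\<^sup>p\<close> is additive under taking all pairwise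
  products. On a geometric family \<open>1, x, x\<^sup>2, \<dots>\<close> it tends to \<open>G\<^sub>p(x)\<close>, so unique factorization
  shows that the sum of \<open>G\<^sub>p(1/P\<^sup>k)\<close> over primes is the limit of \<open>carry / (\<Sum>x)\<^sup>p\<close> on the family
  \<open>1/a\<^sup>k\<close>, \<open>a\<close> monic of degree less than \<open>D\<close>.

  For \<open>k = (q - 1) l\<close> this family consists of the \<open>l\<close>-th powers of \<open>y\<^sub>a = 1/a\<^sup>q\<^sup>-\<^sup>1\<close>. The product
  of \<open>z - a\<close> over all polynomials \<open>a\<close> of degree less than \<open>D\<close> is \<open>q\<close>-linear in \<open>z\<close>, hence
  \<open>\<Prod>(1 - y\<^sub>a w) = 1 + c\<^sub>1 w + c\<^sub>2 w\<^sup>q\<^sup>+\<^sup>1\<close> modulo \<open>w\<^sup>2\<^sup>q\<^sup>+\<^sup>1\<close>. Writing this series as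
  \<open>\<Prod>(1 - a\<^sub>j w\<^sup>j)\<close> expresses \<open>carry\<close> of the \<open>l\<close>-th powers through the Witt coordinates \<open>a\<^sub>j\<close>:
  it vanishes for \<open>l p \<le> q\<close>, and \<open>carry / (\<Sum>x)\<^sup>p = l c\<^sub>2 / c\<^sub>1\<^sup>q\<^sup>+\<^sup>1\<close> for \<open>q < l p \<le> 2 q\<close>.
  Two recursions in \<open>D\<close> for \<open>c\<^sub>1\<close> and \<open>c\<^sub>2\<close> give the limit of \<open>c\<^sub>2 / c\<^sub>1\<^sup>q\<^sup>+\<^sup>1\<close>.
\<close>

unbundle no vec_syntax

section \<open>The free commutative ring and the carry polynomial\<close>

text \<open>
  The ring of integer polynomials in variables indexed by the elements of a commutative ring
  \<open>'r\<close> maps onto \<open>'r\<close> and has no torsion, so an identity of integer polynomials may be proved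
  there after multiplication by \<open>p\<close> and then be evaluated in \<open>'r\<close>, even if \<open>p = 0\<close> in \<open>'r\<close>.
\<close>

definition free_eval :: "('r::comm_ring_1 multiset \<Rightarrow>\<^sub>0 int) \<Rightarrow> 'r" where
  "free_eval f = (\<Sum>m\<in>Poly_Mapping.keys f. of_int (Poly_Mapping.lookup f m) * prod_mset m)"

definition free_var :: "'r \<Rightarrow> ('r multiset \<Rightarrow>\<^sub>0 int)" where
  "free_var x = Poly_Mapping.single {#x#} 1"

lemma free_eval_superset:
  assumes "finite S" "Poly_Mapping.keys f \<subseteq> S"
  shows "free_eval f = (\<Sum>m\<in>S. of_int (Poly_Mapping.lookup f m) * prod_mset m)"
  unfolding free_eval_def using assms
  by (intro sum.mono_neutral_left) (auto simp: in_keys_iff)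

lemma free_eval_0 [simp]: "free_eval 0 = 0"
  by (simp add: free_eval_def)

lemma free_eval_add: "free_eval (f + g) = free_eval f + free_eval g"
proof -
  let ?S = "Poly_Mapping.keys f \<union> Poly_Mapping.keys g"
  have "free_eval (f + g) = (\<Sum>m\<in>?S. of_int (Poly_Mapping.lookup (f + g) m) * prod_mset m)"
    using keys_add[of f g] by (intro free_eval_superset) auto
  moreover have "free_eval f = (\<Sum>m\<in>?S. of_int (Poly_Mapping.lookup f m) * prod_mset m)"
    "free_eval g = (\<Sum>m\<in>?S. of_int (Poly_Mapping.lookup g m) * prod_mset m)"
    by (auto intro!: free_eval_superset)
  ultimately show ?thesis
    by (simp add: lookup_add distrib_right sum.distrib)
qed

lemma free_eval_single: "free_eval (Poly_Mapping.single m c) = of_int c * prod_mset m"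
  by (cases "c = 0") (simp_all add: free_eval_def)

lemma free_eval_var [simp]: "free_eval (free_var x) = x"
  by (simp add: free_var_def free_eval_single)

lemma free_eval_1 [simp]: "free_eval 1 = 1"
  using free_eval_single[of 0 1] by simp

lemma free_eval_sum: "free_eval (sum f A) = (\<Sum>i\<in>A. free_eval (f i))"
  by (induction A rule: infinite_finite_induct) (simp_all add: free_eval_add)

lemma poly_mapping_eq_sum_single:
  "f = (\<Sum>m\<in>Poly_Mapping.keys f. Poly_Mapping.single m (Poly_Mapping.lookup f m))"
  by (rule poly_mapping_eqI)
    (auto simp: lookup_sum lookup_single when_def sum.delta' in_keys_iff if_distrib cong: if_cong)

lemma free_eval_mult: "free_eval (f * g) = free_eval f * free_eval g"
proof -
  have "f * g = (\<Sum>m\<in>Poly_Mapping.keys f. \<Sum>m'\<in>Poly_Mapping.keys g.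
          Poly_Mapping.single (m + m') (Poly_Mapping.lookup f m * Poly_Mapping.lookup g m'))"
    by (subst (1) poly_mapping_eq_sum_single[of f], subst (1) poly_mapping_eq_sum_single[of g])
      (simp add: sum_product mult_single)
  then show ?thesis
    by (simp add: free_eval_sum free_eval_single)
      (simp add: free_eval_def sum_product mult_ac)
qed

lemma free_eval_minus: "free_eval (f - g) = free_eval f - free_eval g"
  using free_eval_add[of "f - g" g] by (simp add: algebra_simps)

lemma free_eval_uminus: "free_eval (- f) = - free_eval f"
  using free_eval_minus[of 0 f] by simp

lemma free_eval_power: "free_eval (f ^ n) = free_eval f ^ n"
  by (induction n) (simp_all add: free_eval_mult)

lemma free_eval_of_nat: "free_eval (of_nat n) = of_nat n"
  by (induction n) (simp_all add: free_eval_add)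

lemma free_eval_of_int: "free_eval (of_int c) = of_int c"
  by (cases c) (simp_all add: free_eval_of_nat free_eval_uminus del: of_nat_Suc)

lemma free_eval_sum_list: "free_eval (sum_list xs) = sum_list (map free_eval xs)"
  by (induction xs) (simp_all add: free_eval_add)

lemmas free_eval_hom = free_eval_add free_eval_minus free_eval_mult free_eval_power free_eval_sum
  free_eval_of_int free_eval_of_nat free_eval_sum_list

lemma lookup_of_nat_mult:
  fixes f :: "('r::comm_monoid_add \<Rightarrow>\<^sub>0 int)"
  shows "Poly_Mapping.lookup (of_nat n * f) m = int n * Poly_Mapping.lookup f m"
  by (induction n) (simp_all add: lookup_add distrib_right)

lemma of_nat_mult_cancel_poly_mapping:
  fixes f g :: "('r::comm_monoid_add \<Rightarrow>\<^sub>0 int)"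
  assumes "of_nat n * f = of_nat n * g" "n > 0"
  shows "f = g"
proof (rule poly_mapping_eqI)
  fix m show "Poly_Mapping.lookup f m = Poly_Mapping.lookup g m"
    using arg_cong[OF assms(1), of "\<lambda>h. Poly_Mapping.lookup h m"] assms(2)
    by (simp add: lookup_of_nat_mult)
qed

definition free_list :: "'r list \<Rightarrow> ('r multiset \<Rightarrow>\<^sub>0 int) list" where
  "free_list = map free_var"

lemma map_free_eval_free_list [simp]: "map free_eval (free_list xs) = xs"
  by (induction xs) (simp_all add: free_list_def)

text \<open>The recursion only divides binomial coefficients by \<open>p\<close>; these divisions are exact for prime \<open>p\<close>.\<close>

primrec carry :: "nat \<Rightarrow> 'r::comm_ring_1 list \<Rightarrow> 'r" where
  "carry p [] = 0"
| "carry p (x # xs) =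
    carry p xs + (\<Sum>i\<in>{1..<p}. of_nat ((p choose i) div p) * x ^ i * sum_list xs ^ (p - i))"

text \<open>The binomial theorem for \<open>x + sum_list xs\<close>: the extreme terms are
  \<open>p\<close>-th powers, and the middle coefficients are exact multiples of the prime
  \<open>p\<close>. Where \<open>p = 0\<close> the identity says nothing about \<open>carry\<close>,
  which is why it is applied in the free ring.\<close>

lemma of_nat_carry:
  fixes xs :: "'r::comm_ring_1 list"
  assumes "prime p"
  shows "of_nat p * carry p xs = sum_list xs ^ p - (\<Sum>x\<leftarrow>xs. x ^ p)"
proof (induction xs)
  case Nil
  then show ?case using prime_gt_0_nat[OF assms] by (simp add: power_0_left)
next
  case (Cons x xs)
  let ?s = "sum_list xs"
  have p: "p > 1" using assms prime_gt_1_nat by blast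
  have "(x + ?s) ^ p = (\<Sum>i\<le>p. of_nat (p choose i) * x ^ i * ?s ^ (p - i))"
    by (rule binomial_ring)
  also have "{..p} = insert 0 (insert p {1..<p})" using p by auto
  also have "(\<Sum>i\<in>\<dots>. of_nat (p choose i) * x ^ i * ?s ^ (p - i))
      = x ^ p + ?s ^ p + (\<Sum>i\<in>{1..<p}. of_nat (p choose i) * x ^ i * ?s ^ (p - i))"
    using p by (simp add: algebra_simps)
  also have "(\<Sum>i\<in>{1..<p}. of_nat (p choose i) * x ^ i * ?s ^ (p - i))
      = of_nat p * (\<Sum>i\<in>{1..<p}. of_nat ((p choose i) div p) * x ^ i * ?s ^ (p - i))"
    unfolding sum_distrib_left
  proof (rule sum.cong[OF refl])
    fix i assume i: "i \<in> {1..<p}"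
    then have "p dvd (p choose i)" using assms by (intro dvd_choose_prime) auto
    then have "of_nat (p choose i) = (of_nat p * of_nat ((p choose i) div p) :: 'r)"
      by (metis dvd_mult_div_cancel of_nat_mult)
    then show "of_nat (p choose i) * x ^ i * ?s ^ (p - i)
      = of_nat p * (of_nat ((p choose i) div p) * x ^ i * ?s ^ (p - i))"
      by (simp add: mult.assoc)
  qed
  finally show ?case using Cons.IH by (simp add: algebra_simps)
qed

lemma free_eval_carry: "free_eval (carry p xs) = carry p (map free_eval xs)"
  by (induction xs) (simp_all add: free_eval_hom)

lemma carry_replicate_0: "carry p (replicate n 0) = 0"
  by (induction n) (auto simp: power_0_left sum_list_replicate intro!: sum.neutral)

lemma carry_all_0:
  assumes "set xs \<subseteq> {0}"
  shows "carry p xs = 0"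
  using assms carry_replicate_0[of p "length xs"] by (metis (no_types, lifting) replicate_eqI subset_singletonD empty_iff insert_iff)

lemma carry_Cons_0:
  assumes "set xs \<subseteq> {0}"
  shows "carry p (x # xs) = 0"
proof -
  have "sum_list xs = 0" using assms by (induction xs) auto
  then show ?thesis using carry_all_0[OF assms] by (auto simp: power_0_left intro!: sum.neutral)
qed

text \<open>The recursion runs along the list and hides the symmetry. After lifting to variables,
  \<open>p * carry\<close> is visibly symmetric; cancelling \<open>p\<close> and evaluating brings
  the symmetry back. The later identities for \<open>carry\<close> are proved by the same lift,
  cancellation and evaluation.\<close>

lemma carry_perm:
  fixes xs ys :: "'r::comm_ring_1 list"
  assumes "prime p" "mset xs = mset ys"
  shows "carry p xs = carry p ys"
proof -
  have *: "mset (free_list xs) = mset (free_list ys)"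
    using assms(2) by (simp add: free_list_def)
  then have "sum_list (free_list xs) = sum_list (free_list ys)"
    by (metis sum_mset_sum_list)
  moreover have "(\<Sum>x\<leftarrow>free_list xs. x ^ p) = (\<Sum>x\<leftarrow>free_list ys. x ^ p)"
    using * by (metis mset_map sum_mset_sum_list)
  ultimately have "of_nat p * carry p (free_list xs) = of_nat p * carry p (free_list ys)"
    by (simp add: of_nat_carry[OF assms(1)])
  then have "carry p (free_list xs) = carry p (free_list ys)"
    using of_nat_mult_cancel_poly_mapping prime_gt_0_nat[OF assms(1)] by blast
  then have "free_eval (carry p (free_list xs)) = free_eval (carry p (free_list ys))"
    by simp
  then show ?thesis by (simp add: free_eval_carry)
qed

section \<open>The carry of pairwise products and of geometric families\<close>

definition list_times :: "'r::times list \<Rightarrow> 'r list \<Rightarrow> 'r list" where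
  "list_times xs ys = concat (map (\<lambda>x. map ((*) x) ys) xs)"

lemma list_times_Nil [simp]: "list_times [] ys = []"
  by (simp add: list_times_def)

lemma list_times_Cons [simp]: "list_times (x # xs) ys = map ((*) x) ys @ list_times xs ys"
  by (simp add: list_times_def)

lemma map_list_times:
  assumes "\<And>x y. f (x * y) = f x * f y"
  shows "map f (list_times xs ys) = list_times (map f xs) (map f ys)"
  by (induction xs) (simp_all add: assms)

lemma sum_list_list_times:
  fixes xs :: "'r::comm_ring_1 list"
  shows "sum_list (list_times xs ys) = sum_list xs * sum_list ys"
  by (induction xs) (simp_all add: sum_list_const_mult distrib_right)

text \<open>With sums \<open>s\<close>, \<open>t\<close> and \<open>p\<close>-th power sums
  \<open>P\<close>, \<open>Q\<close>, this is
  \<open>(s t)^p - P Q = (s^p - P) t^p + P (t^p - Q)\<close> divided by \<open>p\<close>. In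
  characteristic \<open>p\<close> also \<open>P = s^p\<close>, so division by \<open>(s t)^p\<close>
  makes the carry quotient additive.\<close>

lemma carry_list_times:
  fixes xs ys :: "'r::comm_ring_1 list"
  assumes "prime p"
  shows "carry p (list_times xs ys) = carry p xs * sum_list ys ^ p + (\<Sum>x\<leftarrow>xs. x ^ p) * carry p ys"
proof -
  let ?xs = "free_list xs" and ?ys = "free_list ys"
  have pw: "(\<Sum>x\<leftarrow>list_times ?xs ?ys. x ^ p) = (\<Sum>x\<leftarrow>?xs. x ^ p) * (\<Sum>x\<leftarrow>?ys. x ^ p)"
    using map_list_times[of "\<lambda>x. x ^ p" ?xs ?ys]
    by (simp add: sum_list_list_times power_mult_distrib)
  have "of_nat p * carry p (list_times ?xs ?ys)
    = (sum_list ?xs * sum_list ?ys) ^ p - (\<Sum>x\<leftarrow>?xs. x ^ p) * (\<Sum>x\<leftarrow>?ys. x ^ p)"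
    by (simp add: of_nat_carry[OF assms] pw sum_list_list_times)
  also have "\<dots> = (sum_list ?xs ^ p - (\<Sum>x\<leftarrow>?xs. x ^ p)) * sum_list ?ys ^ p
     + (\<Sum>x\<leftarrow>?xs. x ^ p) * (sum_list ?ys ^ p - (\<Sum>x\<leftarrow>?ys. x ^ p))"
    by (simp add: power_mult_distrib algebra_simps)
  also have "\<dots> = of_nat p * (carry p ?xs * sum_list ?ys ^ p + (\<Sum>x\<leftarrow>?xs. x ^ p) * carry p ?ys)"
    unfolding of_nat_carry[OF assms, symmetric] by (simp add: algebra_simps)
  finally have "carry p (list_times ?xs ?ys)
      = carry p ?xs * sum_list ?ys ^ p + (\<Sum>x\<leftarrow>?xs. x ^ p) * carry p ?ys"
    using of_nat_mult_cancel_poly_mapping prime_gt_0_nat[OF assms] by blast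
  from arg_cong[OF this, of free_eval] show ?thesis
    by (simp add: free_eval_hom free_eval_carry map_list_times free_list_def o_def)
qed

lemma poly_map_poly_of_int_free_eval:
  "free_eval (poly (map_poly of_int g) x) = poly (map_poly of_int g) (free_eval x)"
  by (induction g) (simp_all add: map_poly_pCons free_eval_hom)

lemma of_nat_poly_G_numerator:
  fixes x :: "'r::comm_ring_1"
  assumes "prime p"
  shows "of_nat p * poly (map_poly of_int (G_numerator p)) x = 1 - x ^ p - (1 - x) ^ p"
proof -
  have hom: "poly (map_poly of_int (smult c f)) x = of_int c * poly (map_poly of_int f) x" for c f
    by (induction f) (simp_all add: map_poly_pCons algebra_simps)
  have hom_add: "poly (map_poly of_int (f + g)) x = poly (map_poly of_int f) x + poly (map_poly of_int g) x" for f g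
    by (induction f g rule: poly_induct2) (simp_all add: map_poly_pCons algebra_simps)
  have add: "poly (map_poly of_int (f - g)) x = poly (map_poly of_int f) x - poly (map_poly of_int g) x" for f g
    using hom_add[of "f - g" g] by (simp add: algebra_simps)
  have mult: "poly (map_poly of_int (f * g)) x = poly (map_poly of_int f) x * poly (map_poly of_int g) x" for f g
    by (induction f) (simp_all add: map_poly_pCons hom hom_add algebra_simps)
  have pow: "poly (map_poly of_int (f ^ n)) x = poly (map_poly of_int f) x ^ n" for f n
    by (induction n) (simp_all add: mult one_pCons map_poly_pCons)
  have mon: "poly (map_poly of_int (monom 1 n)) x = x ^ n" for n
    by (simp add: map_poly_monom poly_monom)
  have "poly (map_poly of_int (smult (int p) (G_numerator p))) x
     = poly (map_poly of_int ((1 - monom 1 p) - (1 - monom 1 1) ^ p)) x"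
    by (simp only: G_numerator_exact[OF assms])
  then show ?thesis
    by (simp add: hom add pow mon)
qed

text \<open>Multiplication by \<open>(1 - x)^p\<close> clears the denominators of the geometric
  sums. Truncation after \<open>N\<close> terms leaves the boundary term \<open>g (x ^ N)\<close>,
  which is negligible when \<open>x\<close> has positive valuation.\<close>

lemma carry_geometric:
  fixes x :: "'r::comm_ring_1"
  assumes "prime p"
  defines "g \<equiv> \<lambda>x::'r. poly (map_poly of_int (G_numerator p)) x"
  shows "(1 - x) ^ p * carry p (map ((^) x) [0..<N])
    = g x * (\<Sum>i\<leftarrow>[0..<N]. (x ^ i) ^ p) - g (x ^ N)"
proof -
  let ?x = "free_var x"
  let ?g = "\<lambda>x. poly (map_poly of_int (G_numerator p)) x"
  let ?c = "carry p (map ((^) ?x) [0..<N])"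
  define t where "t = (\<Sum>i\<leftarrow>[0..<N]. (?x ^ i) ^ p)"
  define s where "s = (\<Sum>i\<leftarrow>[0..<N]. ?x ^ i)"
  have geo: "(1 - y) * (\<Sum>i\<leftarrow>[0..<N]. y ^ i) = 1 - y ^ N" for y :: "'r multiset \<Rightarrow>\<^sub>0 int"
    by (simp add: one_diff_power_eq lessThan_atLeast0 interv_sum_list_conv_sum_set_nat)
  have 1: "(1 - ?x) ^ p * s ^ p = (1 - ?x ^ N) ^ p"
    unfolding s_def using geo[of ?x] by (simp flip: power_mult_distrib)
  have 2: "(1 - ?x ^ p) * t = 1 - (?x ^ N) ^ p"
    unfolding t_def using geo[of "?x ^ p"] by (simp add: mult.commute flip: power_mult)
  have "of_nat p * ((1 - ?x) ^ p * ?c) = (1 - ?x) ^ p * (s ^ p - t)"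
    using of_nat_carry[OF assms(1), of "map ((^) ?x) [0..<N]"]
    by (simp add: s_def t_def o_def mult.left_commute[of "of_nat p"])
  also have "\<dots> = (1 - ?x ^ N) ^ p - (1 - ?x) ^ p * t"
    by (simp add: right_diff_distrib 1)
  \<comment> \<open>The two sides differ by \<open>(1 - ?x ^ p) * t - (1 - (?x ^ N) ^ p)\<close>,
    which is zero by the second geometric sum.\<close>
  also have "\<dots> = (1 - ?x ^ p - (1 - ?x) ^ p) * t - (1 - (?x ^ N) ^ p - (1 - ?x ^ N) ^ p)"
    using 2 by (simp add: algebra_simps)
  also have "\<dots> = of_nat p * (?g ?x * t - ?g (?x ^ N))"
    unfolding of_nat_poly_G_numerator[OF assms(1), symmetric] by (simp add: algebra_simps)
  finally have "(1 - ?x) ^ p * ?c = ?g ?x * t - ?g (?x ^ N)"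
    using of_nat_mult_cancel_poly_mapping prime_gt_0_nat[OF assms(1)] by blast
  from arg_cong[OF this, of free_eval] show ?thesis
    by (simp add: free_eval_hom free_eval_carry poly_map_poly_of_int_free_eval t_def g_def o_def)
qed

section \<open>Witt coordinates of a power series\<close>

text \<open>\<open>S\<close> is minus the logarithmic derivative \<open>X F' / F\<close>; for \<open>F = \<Prod>(1 - x X)\<close> its coefficients are the power sums of the \<open>x\<close>.\<close>

definition has_log_deriv :: "'r::comm_ring_1 fps \<Rightarrow> 'r fps \<Rightarrow> bool" where
  "has_log_deriv F S \<longleftrightarrow> fps_X * fps_deriv F = - (F * S)"

lemma has_log_deriv_1: "has_log_deriv 1 0"
  by (simp add: has_log_deriv_def)

lemma has_log_deriv_mult:
  assumes "has_log_deriv F S" "has_log_deriv H R"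
  shows "has_log_deriv (F * H) (S + R)"
proof -
  have "fps_X * fps_deriv (F * H) = (fps_X * fps_deriv F) * H + F * (fps_X * fps_deriv H)"
    by (simp add: algebra_simps)
  also have "\<dots> = - (F * H * (S + R))"
    using assms by (simp add: has_log_deriv_def algebra_simps)
  finally show ?thesis by (simp add: has_log_deriv_def)
qed

lemma has_log_deriv_prod:
  assumes "\<And>i. i \<in> A \<Longrightarrow> has_log_deriv (F i) (S i)"
  shows "has_log_deriv (prod F A) (sum S A)"
  using assms
  by (induction A rule: infinite_finite_induct) (simp_all add: has_log_deriv_1 has_log_deriv_mult)

lemma has_log_deriv_prod_list:
  assumes "\<And>x. has_log_deriv (F x) (S x)"
  shows "has_log_deriv (prod_list (map F xs)) (sum_list (map S xs))"
  using assms by (induction xs) (simp_all add: has_log_deriv_1 has_log_deriv_mult)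

definition witt_factor :: "'r::comm_ring_1 \<Rightarrow> nat \<Rightarrow> 'r fps" where
  "witt_factor a j = 1 - fps_const a * fps_X ^ j"

lemma fps_nth_mult_witt_factor:
  "(F * witt_factor a j) $ i = F $ i - (if i < j then 0 else a * F $ (i - j))"
  by (simp add: witt_factor_def right_diff_distrib mult.left_commute[of F] fps_X_power_mult_right_nth)

lemma fps_nth_witt_factor:
  "j > 0 \<Longrightarrow> witt_factor a j $ i = (if i = 0 then 1 else if i = j then - a else 0)"
  by (auto simp: witt_factor_def fps_X_power_iff)

lemma has_log_deriv_witt_factor:
  fixes a :: "'r::comm_ring_1"
  assumes "j > 0"
  shows "has_log_deriv (witt_factor a j)
     (Abs_fps (\<lambda>m. if m > 0 \<and> j dvd m then of_nat j * a ^ (m div j) else 0))" (is "has_log_deriv _ ?S")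
  unfolding has_log_deriv_def
proof (rule fps_ext)
  fix m
  have l: "(fps_X * fps_deriv (witt_factor a j)) $ m = of_nat m * witt_factor a j $ m"
    by (cases m) simp_all
  have r: "(- (witt_factor a j * ?S)) $ m = - (?S $ m - (if m < j then 0 else a * ?S $ (m - j)))"
    using fps_nth_mult_witt_factor[of ?S a j m] by (simp add: mult.commute)
  consider "m < j" | "m = j" | "m > j" "j dvd m" | "m > j" "\<not> j dvd m" by linarith
  then show "(fps_X * fps_deriv (witt_factor a j)) $ m = (- (witt_factor a j * ?S)) $ m"
  proof cases
    case 1
    then have "\<not> (m > 0 \<and> j dvd m)" by (auto dest: dvd_imp_le)
    then show ?thesis unfolding l r using 1 assms by (auto simp: fps_nth_witt_factor)
  next
    case 2
    then show ?thesis unfolding l r using assms by (simp add: fps_nth_witt_factor)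
  next
    case 3
    then obtain c where c: "m = j * c" by blast
    with 3 assms have "c > 1" by auto
    then obtain d where d: "c = Suc d" "d > 0" by (cases c) auto
    then have "m - j = j * d" by (simp add: c)
    then show ?thesis unfolding l r using 3 assms c d by (simp add: fps_nth_witt_factor mult_ac)
  next
    case 4
    then have "\<not> j dvd (m - j)" by (simp add: dvd_minus_self)
    then show ?thesis unfolding l r using 4 assms by (simp add: fps_nth_witt_factor)
  qed
qed

text \<open>Newton's identities: since the constant term is \<open>1\<close>, the coefficient of
  \<open>X^i\<close> in the defining equation expresses the \<open>i\<close>-th coefficient of the
  logarithmic derivative through earlier ones and the coefficients of the series up to
  \<open>i\<close>.\<close>

lemma log_deriv_unique:
  fixes F H :: "'r::comm_ring_1 fps"
  assumes "has_log_deriv F S" "has_log_deriv H R" "F $ 0 = 1" "H $ 0 = 1"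
    and "\<And>i. i \<le> M \<Longrightarrow> F $ i = H $ i" "i \<le> M"
  shows "S $ i = R $ i"
  using assms(6)
proof (induction i rule: less_induct)
  case (less i)
  have *: "E $ 0 = 1 \<Longrightarrow> has_log_deriv E Q \<Longrightarrow>
      Q $ i = - of_nat i * E $ i - (\<Sum>k\<in>{1..i}. E $ k * Q $ (i - k))" for E Q :: "'r fps"
  proof -
    assume E: "E $ 0 = 1" "has_log_deriv E Q"
    have "of_nat i * E $ i = (fps_X * fps_deriv E) $ i" by (cases i) simp_all
    also have "\<dots> = - (\<Sum>k=0..i. E $ k * Q $ (i - k))"
      using E(2) by (simp add: has_log_deriv_def fps_mult_nth)
    also have "{0..i} = insert 0 {1..i}" by auto
    finally show ?thesis using E(1) by simp
  qed
  have "(\<Sum>k\<in>{1..i}. F $ k * S $ (i - k)) = (\<Sum>k\<in>{1..i}. H $ k * R $ (i - k))"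
    using less assms(5) by (intro sum.cong) auto
  with *[OF assms(3,1)] *[OF assms(4,2)] assms(5)[OF less.prems] show ?case by simp
qed

section \<open>Witt products, their coordinates and their ghost components\<close>

definition witt_prod :: "(nat \<Rightarrow> 'r::comm_ring_1) \<Rightarrow> nat \<Rightarrow> 'r fps" where
  "witt_prod a M = (\<Prod>j\<in>{1..M}. witt_factor (a j) j)"

lemma witt_prod_0 [simp]: "witt_prod a 0 = 1"
  by (simp add: witt_prod_def)

lemma witt_prod_Suc: "witt_prod a (Suc M) = witt_prod a M * witt_factor (a (Suc M)) (Suc M)"
  by (simp add: witt_prod_def)

lemma witt_prod_nth_0 [simp]: "witt_prod a M $ 0 = 1"
  by (induction M) (simp_all add: witt_prod_Suc fps_nth_witt_factor)

lemma witt_prod_cong: "(\<And>j. 1 \<le> j \<Longrightarrow> j \<le> M \<Longrightarrow> a j = b j) \<Longrightarrow> witt_prod a M = witt_prod b M"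
  unfolding witt_prod_def by (intro prod.cong) auto

text \<open>The factor with index \<open>Suc M\<close> leaves all coefficients up to
  \<open>M\<close> alone and subtracts its parameter from the next one, so the coordinates can be
  solved for one after another. The same triangularity gives
  \<open>witt_prod_unique\<close>.\<close>

lemma witt_prod_exists:
  assumes "F $ 0 = 1"
  shows "\<exists>a. \<forall>i\<le>M. witt_prod a M $ i = F $ i"
proof (induction M)
  case 0
  then show ?case using assms by simp
next
  case (Suc M)
  then obtain a where a: "\<And>i. i \<le> M \<Longrightarrow> witt_prod a M $ i = F $ i" by blast
  define b where "b = a(Suc M := witt_prod a M $ Suc M - F $ Suc M)"
  have "witt_prod b M = witt_prod a M"
    by (rule witt_prod_cong) (simp add: b_def)
  then have "witt_prod b (Suc M) $ i = F $ i" if "i \<le> Suc M" for i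
    using that a by (cases "i = Suc M") (simp_all add: witt_prod_Suc fps_nth_mult_witt_factor b_def)
  then show ?case by blast
qed

lemma witt_prod_unique:
  assumes "\<And>i. i \<le> M \<Longrightarrow> witt_prod a M $ i = witt_prod b M $ i" "1 \<le> j" "j \<le> M"
  shows "a j = b j"
  using assms
proof (induction M arbitrary: j)
  case (Suc M)
  have *: "witt_prod c (Suc M) $ i = (if i \<le> M then witt_prod c M $ i
      else witt_prod c M $ i - c (Suc M))" if "i \<le> Suc M" for c :: "nat \<Rightarrow> 'a" and i
    using that by (cases "i = Suc M") (auto simp: witt_prod_Suc fps_nth_mult_witt_factor)
  have eq: "witt_prod a M $ i = witt_prod b M $ i" if "i \<le> M" for i
    using Suc.prems(1)[of i] that by (simp add: *)
  have ab: "a j = b j" if "1 \<le> j" "j \<le> M" for j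
    using Suc.IH[OF eq that] .
  then have "witt_prod a M = witt_prod b M" by (intro witt_prod_cong)
  then have "a (Suc M) = b (Suc M)"
    using Suc.prems(1)[of "Suc M"] by (simp add: *)
  with ab show ?case using Suc.prems by (cases "j = Suc M") auto
qed simp

definition char_fps :: "'r::comm_ring_1 list \<Rightarrow> 'r fps" where
  "char_fps xs = prod_list (map (\<lambda>x. witt_factor x 1) xs)"

lemma char_fps_nth_0 [simp]: "char_fps xs $ 0 = 1"
  by (induction xs) (simp_all add: char_fps_def fps_nth_witt_factor)

lemma fps_nth_sum_list: "sum_list (map f xs) $ n = sum_list (map (\<lambda>x. f x $ n) xs)"
  by (induction xs) simp_all

lemma divisor_bounds:
  assumes "0 < (m::nat)" "j dvd m"
  shows "1 \<le> j \<and> j \<le> m"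
  using assms by (simp add: dvd_imp_le Suc_leI dvd_pos_nat)

text \<open>Both products agree up to degree \<open>M\<close>, hence so do their logarithmic
  derivatives: one has the power sums as coefficients, the other the ghost components of the Witt
  coordinates.\<close>

lemma power_sum_eq_witt_ghost:
  fixes xs :: "'r::comm_ring_1 list"
  assumes "\<And>i. i \<le> M \<Longrightarrow> witt_prod a M $ i = char_fps xs $ i" "0 < m" "m \<le> M"
  shows "(\<Sum>x\<leftarrow>xs. x ^ m) = (\<Sum>j | j dvd m. of_nat j * a j ^ (m div j))"
proof -
  let ?S = "\<lambda>a j. Abs_fps (\<lambda>m. if m > 0 \<and> j dvd m then of_nat j * a ^ (m div j) else 0) :: 'r fps"
  have "has_log_deriv (char_fps xs) (\<Sum>x\<leftarrow>xs. ?S x 1)"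
    unfolding char_fps_def by (intro has_log_deriv_prod_list has_log_deriv_witt_factor) simp
  moreover have "has_log_deriv (witt_prod a M) (\<Sum>j\<in>{1..M}. ?S (a j) j)"
    unfolding witt_prod_def by (intro has_log_deriv_prod has_log_deriv_witt_factor) simp
  ultimately have "(\<Sum>x\<leftarrow>xs. ?S x 1) $ m = (\<Sum>j\<in>{1..M}. ?S (a j) j) $ m"
    by (rule log_deriv_unique) (use assms in auto)
  then have "(\<Sum>x\<leftarrow>xs. x ^ m) = (\<Sum>j\<in>{1..M}. if j dvd m then of_nat j * a j ^ (m div j) else 0)"
    using assms(2) by (simp add: fps_nth_sum_list fps_sum_nth)
  also have "\<dots> = (\<Sum>j\<in>{j\<in>{1..M}. j dvd m}. of_nat j * a j ^ (m div j))"
    by (simp add: sum.If_cases Int_def)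
  also have "{j\<in>{1..M}. j dvd m} = {j. j dvd m}"
    using divisor_bounds[OF assms(2)] assms(3) by fastforce
  finally show ?thesis .
qed

section \<open>Evaluation of series over the free ring, and the carry of a family of powers\<close>

definition fps_eval :: "('r::comm_ring_1 multiset \<Rightarrow>\<^sub>0 int) fps \<Rightarrow> 'r fps" where
  "fps_eval F = Abs_fps (\<lambda>i. free_eval (F $ i))"

lemma fps_eval_mult: "fps_eval (F * H) = fps_eval F * fps_eval H"
  by (rule fps_ext) (simp add: fps_eval_def fps_mult_nth free_eval_hom)

lemma fps_eval_1 [simp]: "fps_eval 1 = 1"
  by (rule fps_ext) (simp add: fps_eval_def)

lemma fps_eval_witt_factor: "j > 0 \<Longrightarrow> fps_eval (witt_factor a j) = witt_factor (free_eval a) j"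
  using free_eval_minus[of 0 a]
  by (intro fps_ext) (auto simp: fps_eval_def fps_nth_witt_factor)

lemma fps_eval_char_fps: "fps_eval (char_fps xs) = char_fps (map free_eval xs)"
  by (induction xs) (simp_all add: char_fps_def fps_eval_mult fps_eval_witt_factor)

lemma fps_eval_witt_prod: "fps_eval (witt_prod a M) = witt_prod (\<lambda>j. free_eval (a j)) M"
  by (induction M) (simp_all add: witt_prod_Suc fps_eval_mult fps_eval_witt_factor)

text \<open>The weight \<open>j\<close> of a ghost component is realized by repetition. The sum of
  this list is thus the \<open>l\<close>-th ghost component, and its \<open>p\<close>-th power sum
  is the part of the component of index \<open>l * p\<close> that comes from the divisors of
  \<open>l\<close>.\<close>

definition witt_carry_list :: "nat \<Rightarrow> (nat \<Rightarrow> 'r::comm_ring_1) \<Rightarrow> 'r list" where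
  "witt_carry_list l a =
    concat (map (\<lambda>j. replicate j (a j ^ (l div j))) (filter (\<lambda>j. j dvd l) [1..<Suc l]))"

lemma sum_list_map_concat_replicate:
  fixes f :: "'b \<Rightarrow> 'r::comm_ring_1"
  shows "sum_list (map f (concat (map (\<lambda>j. replicate j (b j)) js)))
     = (\<Sum>j\<leftarrow>js. of_nat j * f (b j))"
  by (induction js) (simp_all add: sum_list_replicate)

lemma sum_list_witt_carry_list:
  fixes a :: "nat \<Rightarrow> 'r::comm_ring_1"
  assumes "l > 0"
  shows "sum_list (map f (witt_carry_list l a)) = (\<Sum>j | j dvd l. of_nat j * (f (a j ^ (l div j)) :: 'r))"
proof -
  have "set (filter (\<lambda>j. j dvd l) [1..<Suc l]) = {j. j dvd l}"
    using divisor_bounds[OF assms] by fastforce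
  then show ?thesis
    unfolding witt_carry_list_def sum_list_map_concat_replicate
    by (subst sum_list_distinct_conv_sum_set) simp_all
qed

lemma prime_dvd_of_dvd_mult_not_dvd:
  assumes "prime (p::nat)" "j dvd l * p" "\<not> j dvd l"
  shows "p dvd j"
  using assms by (metis coprime_dvd_mult_left_iff prime_imp_coprime coprime_commute)

text \<open>
  In the torsion-free ring, both power sums are ghost components of the same Witt coordinates; the
  divisors \<open>j\<close> of \<open>l\<close> contribute the carry of a family with \<open>j\<close> copies of \<open>a\<^sub>j\<^sup>l\<^sup>/\<^sup>j\<close>, and the
  remaining divisors of \<open>l p\<close> are multiples of \<open>p\<close>.
\<close>

lemma carry_map_power:
  fixes ys :: "'r::comm_ring_1 list"
  assumes p: "prime p" and l: "l > 0"
    and a: "\<And>i. i \<le> l * p \<Longrightarrow> witt_prod a (l * p) $ i = char_fps ys $ i"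
  shows "carry p (map (\<lambda>y. y ^ l) ys) = carry p (witt_carry_list l a)
     - (\<Sum>j | j dvd l * p \<and> \<not> j dvd l. of_nat (j div p) * a j ^ (l * p div j))"
proof -
  have p0: "p > 0" using p by (rule prime_gt_0_nat)
  let ?M = "l * p" and ?ys = "free_list ys"
  obtain b where b: "\<And>i. i \<le> ?M \<Longrightarrow> witt_prod b ?M $ i = char_fps ?ys $ i"
    using witt_prod_exists[of "char_fps ?ys" ?M] by auto
  \<comment> \<open>Evaluating the coordinates \<open>b\<close> gives Witt coordinates of
    \<open>char_fps ys\<close>, and these are unique, so the result must be the given
    \<open>a\<close>.\<close>
  have eq: "free_eval (b j) = a j" if "1 \<le> j" "j \<le> ?M" for j
  proof (rule witt_prod_unique[OF _ that])
    fix i assume i: "i \<le> ?M"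
    have "witt_prod (\<lambda>j. free_eval (b j)) ?M $ i = fps_eval (witt_prod b ?M) $ i"
      by (simp add: fps_eval_witt_prod)
    also have "\<dots> = fps_eval (char_fps ?ys) $ i"
      using b[OF i] by (simp add: fps_eval_def)
    also have "\<dots> = witt_prod a ?M $ i"
      using a[OF i] by (simp add: fps_eval_char_fps)
    finally show "witt_prod (\<lambda>j. free_eval (b j)) ?M $ i = witt_prod a ?M $ i" .
  qed
  define A where "A = {j. j dvd ?M \<and> \<not> j dvd l}"
  have fin: "finite {j. j dvd ?M}" using l p0 by (intro finite_divisors_nat) simp
  have split: "{j. j dvd ?M} = {j. j dvd l} \<union> A" by (auto simp: A_def)
  have M: "0 < ?M" "l \<le> ?M" using l p0 by auto
  have ghost_l: "(\<Sum>x\<leftarrow>?ys. x ^ l) = sum_list (witt_carry_list l b)"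
    using power_sum_eq_witt_ghost[OF b l M(2)] sum_list_witt_carry_list[OF l, of "\<lambda>x. x" b] by simp
  have "(\<Sum>x\<leftarrow>?ys. x ^ ?M) = (\<Sum>j | j dvd ?M. of_nat j * b j ^ (?M div j))"
    using power_sum_eq_witt_ghost[OF b M(1)] by simp
  also have "\<dots> = (\<Sum>j | j dvd l. of_nat j * b j ^ (?M div j)) + (\<Sum>j\<in>A. of_nat j * b j ^ (?M div j))"
    using fin unfolding split by (intro sum.union_disjoint) (auto simp: A_def)
  also have "(\<Sum>j | j dvd l. of_nat j * b j ^ (?M div j)) = (\<Sum>x\<leftarrow>witt_carry_list l b. x ^ p)"
    using sum_list_witt_carry_list[OF l, of "\<lambda>x. x ^ p" b]
    by (auto simp: dvd_div_mult simp flip: power_mult intro!: sum.cong)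
  also have "(\<Sum>j\<in>A. of_nat j * b j ^ (?M div j)) = of_nat p * (\<Sum>j\<in>A. of_nat (j div p) * b j ^ (?M div j))"
    unfolding sum_distrib_left
  proof (rule sum.cong[OF refl])
    fix j assume "j \<in> A"
    then have "p dvd j" using prime_dvd_of_dvd_mult_not_dvd[OF p] by (auto simp: A_def)
    then show "of_nat j * b j ^ (?M div j) = of_nat p * (of_nat (j div p) * b j ^ (?M div j))"
      by (metis dvd_mult_div_cancel mult.assoc of_nat_mult)
  qed
  finally have ghost_M: "(\<Sum>x\<leftarrow>?ys. x ^ ?M) = (\<Sum>x\<leftarrow>witt_carry_list l b. x ^ p)
    + of_nat p * (\<Sum>j\<in>A. of_nat (j div p) * b j ^ (?M div j))" .
  have "of_nat p * carry p (map (\<lambda>y. y ^ l) ?ys) = (\<Sum>x\<leftarrow>?ys. x ^ l) ^ p - (\<Sum>x\<leftarrow>?ys. x ^ ?M)"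
    by (simp add: of_nat_carry[OF p] o_def power_mult)
  also have "\<dots> = of_nat p * (carry p (witt_carry_list l b)
      - (\<Sum>j\<in>A. of_nat (j div p) * b j ^ (?M div j)))"
    unfolding ghost_l ghost_M right_diff_distrib of_nat_carry[OF p] by simp
  finally have "carry p (map (\<lambda>y. y ^ l) ?ys) = carry p (witt_carry_list l b)
      - (\<Sum>j\<in>A. of_nat (j div p) * b j ^ (?M div j))"
    using of_nat_mult_cancel_poly_mapping p0 by blast
  from arg_cong[OF this, of free_eval]
  have "carry p (map (\<lambda>y. y ^ l) ys) = carry p (map free_eval (witt_carry_list l b))
      - (\<Sum>j\<in>A. of_nat (j div p) * free_eval (b j) ^ (?M div j))"
    by (simp add: free_eval_hom free_eval_carry free_list_def o_def)
  also have "map free_eval (witt_carry_list l b) = witt_carry_list l a"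
    unfolding witt_carry_list_def map_concat map_map o_def map_replicate
    using eq M(2) by (intro arg_cong[of _ _ concat] map_cong) (auto simp: free_eval_hom)
  also have "(\<Sum>j\<in>A. of_nat (j div p) * free_eval (b j) ^ (?M div j))
     = (\<Sum>j\<in>A. of_nat (j div p) * a j ^ (?M div j))"
    using divisor_bounds[OF M(1)] by (intro sum.cong) (auto simp: A_def eq)
  finally show ?thesis by (simp add: A_def)
qed

section \<open>Additive polynomials\<close>

lemma poly_to_fls_pCons: "poly_to_fls (pCons a P) = fls_const a + T_fls * poly_to_fls P"
  by (simp add: poly_to_fls_def map_poly_pCons)

lemma poly_to_fls_0 [simp]: "poly_to_fls 0 = 0"
  by (simp add: poly_to_fls_def)

lemma poly_to_fls_1 [simp]: "poly_to_fls 1 = 1"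
  by (simp add: poly_to_fls_pCons one_pCons)

lemma poly_to_fls_add: "poly_to_fls (P + Q) = poly_to_fls P + poly_to_fls Q"
  by (induction P Q rule: poly_induct2) (simp_all add: poly_to_fls_pCons algebra_simps flip: fls_plus_const)

lemma poly_to_fls_smult: "poly_to_fls (smult c P) = fls_const c * poly_to_fls P"
  by (induction P) (simp_all add: poly_to_fls_pCons algebra_simps)

lemma poly_to_fls_mult: "poly_to_fls (P * Q) = poly_to_fls P * poly_to_fls Q"
  by (induction P) (simp_all add: poly_to_fls_pCons poly_to_fls_add poly_to_fls_smult algebra_simps)

lemma poly_to_fls_monom: "poly_to_fls (monom c n) = fls_const c * T_fls ^ n"
  by (induction n) (simp_all add: monom_Suc poly_to_fls_pCons monom_0 mult_ac)

lemma poly_to_fls_subdegree_aux: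
  "P \<noteq> 0 \<Longrightarrow> poly_to_fls P \<noteq> 0 \<and> fls_subdegree (poly_to_fls P) = - int (degree P)"
proof (induction P)
  case (pCons a P)
  show ?case
  proof (cases "P = 0")
    case True
    with pCons show ?thesis by (simp add: poly_to_fls_pCons)
  next
    case False
    let ?R = "T_fls * poly_to_fls P"
    from pCons False have R: "?R \<noteq> 0" "fls_subdegree ?R = - 1 - int (degree P)" by simp_all
    \<comment> \<open>The constant has subdegree \<open>0\<close>, strictly above that of
      \<open>?R\<close>, so no cancellation can occur.\<close>
    then have "fls_subdegree (fls_const a + ?R) = fls_subdegree ?R"
      by (intro fls_subdegree_add_eq2) simp_all
    with R False show ?thesis by (auto simp: poly_to_fls_pCons)
  qed
qed simp

lemma poly_to_fls_eq_0_iff [simp]: "poly_to_fls P = 0 \<longleftrightarrow> P = 0"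
  using poly_to_fls_subdegree_aux by auto

lemma fls_subdegree_poly_to_fls [simp]: "fls_subdegree (poly_to_fls P) = - int (degree P)"
  by (cases "P = 0") (use poly_to_fls_subdegree_aux in auto)

lemma infinite_UNIV_fls: "infinite (UNIV :: 'a::field fls set)"
proof
  assume "finite (UNIV :: 'a fls set)"
  then have "finite (range (\<lambda>n. fls_X ^ n :: 'a fls))" by (rule finite_subset[rotated]) simp
  moreover have "inj (\<lambda>n. fls_X ^ n :: 'a fls)"
    by (rule injI) (metis fls_subdegree_fls_X_pow of_nat_eq_iff)
  ultimately show False using finite_imageD by blast
qed

section \<open>Polynomial identities and spaces of polynomials of bounded degree\<close>

lemma poly_eqI_cofinite:
  fixes P Q :: "'k::field poly"
  assumes "\<And>x. x \<noteq> 0 \<Longrightarrow> poly P x = poly Q x" "infinite (UNIV :: 'k set)"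
  shows "P = Q"
proof (rule ccontr)
  assume "P \<noteq> Q"
  then have "finite {x. poly (P - Q) x = 0}" by (intro poly_roots_finite) simp
  moreover have "UNIV - {0} \<subseteq> {x. poly (P - Q) x = 0}" using assms(1) by auto
  ultimately have "finite (UNIV - {0::'k})" by (rule finite_subset[rotated])
  with assms(2) show False by simp
qed

lemma coeff_pcompose_monom:
  assumes "n > 0"
  shows "coeff (pcompose f (monom 1 n)) (n * j) = coeff (f :: 'k::comm_ring_1 poly) j"
proof (induction f arbitrary: j)
  case (pCons a f)
  then show ?case using assms
    by (cases j; cases n) (simp_all add: pcompose_pCons coeff_monom_mult)
qed simp

text \<open>A condition on coefficients instead of the degree: it admits the zero polynomial also
  for \<open>D = 0\<close>, so that this is always a vector space of dimension \<open>D\<close> over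
  the constants.\<close>

definition polys :: "nat \<Rightarrow> 'a::field poly set" where
  "polys D = {a. \<forall>i\<ge>D. coeff a i = 0}"

definition monics :: "nat \<Rightarrow> 'a::field poly set" where
  "monics D = {a. lead_coeff a = 1 \<and> degree a < D}"

lemma polys_0 [simp]: "polys 0 = {0}"
  by (auto simp: polys_def poly_eq_iff)

lemma zero_in_polys [simp]: "0 \<in> polys D"
  by (simp add: polys_def)

lemma polys_nonzero_iff: "a \<noteq> 0 \<Longrightarrow> a \<in> polys D \<longleftrightarrow> degree a < D"
  using leading_coeff_neq_0[of a] by (auto simp: polys_def coeff_eq_0 not_le[symmetric])

text \<open>One of two ways to gain a dimension: here a new leading term is added, while
  \<open>polys_Suc_eq_pCons\<close> multiplies by the indeterminate and adds a constant. Each yields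
  a recursion for the product over \<open>polys D\<close>.\<close>

lemma polys_Suc_eq_monom:
  "polys (Suc D) = (\<lambda>(c, a). monom c D + a) ` (UNIV \<times> polys D)"
proof (intro equalityI subsetI)
  fix a :: "'a poly" assume a: "a \<in> polys (Suc D)"
  have "a - monom (coeff a D) D \<in> polys D"
    using a by (auto simp: polys_def Suc_le_eq)
  then show "a \<in> (\<lambda>(c, a). monom c D + a) ` (UNIV \<times> polys D)"
    by (intro image_eqI[of _ _ "(coeff a D, a - monom (coeff a D) D)"]) auto
qed (auto simp: polys_def)

lemma inj_on_polys_monom: "inj_on (\<lambda>(c, a). monom c D + a) (UNIV \<times> polys D)"
proof (rule inj_onI, clarify)
  fix c d :: 'a and a b assume *: "a \<in> polys D" "b \<in> polys D" "monom c D + a = monom d D + b"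
  from arg_cong[OF *(3), of "\<lambda>f. coeff f D"] *(1,2) have "c = d" by (simp add: polys_def)
  with * show "c = d \<and> a = b" by simp
qed

lemma polys_Suc_eq_pCons:
  "polys (Suc D) = (\<lambda>(c, a). pCons c a) ` (UNIV \<times> polys D)"
proof (intro equalityI subsetI)
  fix a :: "'a poly" assume a: "a \<in> polys (Suc D)"
  obtain c b where cb: "a = pCons c b" by (cases a)
  with a have "b \<in> polys D" by (auto simp: polys_def coeff_pCons split: nat.splits)
  with cb show "a \<in> (\<lambda>(c, a). pCons c a) ` (UNIV \<times> polys D)" by auto
qed (auto simp: polys_def coeff_pCons split: nat.splits)

lemma inj_on_polys_pCons: "inj_on (\<lambda>(c, a). pCons c a) (UNIV \<times> polys D)"
  by (auto intro: inj_onI)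

lemma finite_polys [simp]: "finite (polys D :: 'a::{field,finite} poly set)"
  by (induction D) (simp_all add: polys_Suc_eq_pCons)

lemma card_polys: "card (polys D :: 'a::{field,finite} poly set) = CARD('a) ^ D"
  by (induction D) (simp_all add: polys_Suc_eq_pCons card_image[OF inj_on_polys_pCons] card_cartesian_product)

lemma monics_subset_polys: "monics D \<subseteq> polys D"
proof
  fix a :: "'a poly" assume "a \<in> monics D"
  then show "a \<in> polys D" by (cases "a = 0") (auto simp: monics_def polys_nonzero_iff)
qed

lemma finite_monics [simp]: "finite (monics D :: 'a::{field,finite} poly set)"
  using finite_subset[OF monics_subset_polys finite_polys] .

lemma polys_minus_0_eq:
  "polys D - {0} = (\<lambda>(a, c). smult c a) ` (monics D \<times> (UNIV - {0}))"
proof (intro equalityI subsetI)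
  fix a :: "'a poly" assume a: "a \<in> polys D - {0}"
  then have "smult (inverse (lead_coeff a)) a \<in> monics D"
    by (auto simp: monics_def polys_nonzero_iff)
  then show "a \<in> (\<lambda>(a, c). smult c a) ` (monics D \<times> (UNIV - {0}))"
    using a by (intro image_eqI[of _ _ "(smult (inverse (lead_coeff a)) a, lead_coeff a)"]) auto
next
  fix b :: "'a poly" assume "b \<in> (\<lambda>(a, c). smult c a) ` (monics D \<times> (UNIV - {0}))"
  then obtain a c where "a \<in> monics D" "c \<noteq> 0" "b = smult c a" by auto
  then show "b \<in> polys D - {0}"
    using monics_subset_polys[of D] by (auto simp: polys_def monics_def)
qed

lemma inj_on_monics_smult: "inj_on (\<lambda>(a, c). smult c a) (monics D \<times> (UNIV - {0}))"
proof (rule inj_onI)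
  fix u v :: "'a poly \<times> 'a"
  assume uv: "u \<in> monics D \<times> (UNIV - {0})" "v \<in> monics D \<times> (UNIV - {0})"
    "(case u of (a, c) \<Rightarrow> smult c a) = (case v of (a, c) \<Rightarrow> smult c a)"
  obtain a c b d where [simp]: "u = (a, c)" "v = (b, d)" by (cases u, cases v)
  have *: "a \<in> monics D" "b \<in> monics D" "c \<noteq> 0" "d \<noteq> 0" "smult c a = smult d b"
    using uv by auto
  from arg_cong[OF *(5), of lead_coeff] *(1-4) have "c = d" by (simp add: monics_def)
  moreover from this have "smult (inverse d) (smult d a) = smult (inverse d) (smult d b)"
    using *(5) by simp
  ultimately show "u = v" using *(4) by simp
qed

section \<open>Products over a finite field, and the elimination between two recursions\<close>

lemma finite_field_power_card:
  fixes x :: "'a::{field,finite}"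
  shows "x ^ CARD('a) = x"
proof (cases "x = 0")
  case False
  have "(\<Prod>y\<in>UNIV-{0}. y) = (\<Prod>y\<in>UNIV-{0}. x * y)"
    by (rule prod.reindex_bij_witness[of _ "\<lambda>y. x * y" "\<lambda>y. y / x"]) (use False in auto)
  also have "\<dots> = x ^ (CARD('a) - 1) * (\<Prod>y\<in>UNIV-{0}. y)"
    by (simp add: prod.distrib card_Diff_singleton)
  finally have "x ^ (CARD('a) - 1) = 1" by simp
  moreover have "CARD('a) = Suc (CARD('a) - 1)" by (simp add: Suc_diff_Suc)
  ultimately show ?thesis by (metis power_Suc mult.right_neutral)
qed simp

lemma card_field_gt_1: "CARD('a::{field,finite}) > 1"
proof -
  have "card {0, 1 :: 'a} \<le> CARD('a)" by (intro card_mono) auto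
  then show ?thesis by simp
qed

text \<open>The homogeneous form of the factorization of \<open>z^q - z\<close>, taken at
  \<open>z = x / y\<close>: two polynomials of degree at most \<open>q\<close> with the same
  coefficient at \<open>q\<close> coincide once they agree at the \<open>q\<close>
  constants.\<close>

lemma prod_minus_const_mult:
  fixes x y :: "'a::{field,finite} fls"
  shows "(\<Prod>c\<in>UNIV. x - fls_const c * y) = x ^ CARD('a) - x * y ^ (CARD('a) - 1)"
proof (cases "y = 0")
  case True
  then show ?thesis using card_field_gt_1[where ?'a = 'a] by (simp add: power_0_left)
next
  case False
  let ?q = "CARD('a)"
  have q: "?q > 1" by (rule card_field_gt_1)
  define f where "f = (\<Prod>c\<in>(UNIV::'a set). [:- fls_const c, 1:])"
  define h where "h = (monom 1 ?q - monom 1 1 :: 'a fls poly)"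
  have deg_f: "degree f = ?q" unfolding f_def by (subst degree_prod_eq_sum_degree) auto
  have "lead_coeff f = 1" unfolding f_def by (subst lead_coeff_prod) simp
  with deg_f have lead_f: "coeff f ?q = 1" by simp
  have "f = h"
  proof (rule poly_eqI_degree_lead_coeff[where A = "range fls_const" and n = ?q])
    show "coeff f ?q = coeff h ?q" using q lead_f by (simp add: h_def)
    have "inj (fls_const :: 'a \<Rightarrow> 'a fls)" by (rule injI) (metis fls_const_nth)
    then show "?q \<le> card (range (fls_const :: 'a \<Rightarrow> 'a fls))" by (simp add: card_image)
    show "degree f \<le> ?q" by (simp add: deg_f)
    show "degree h \<le> ?q" unfolding h_def using q
      by (intro degree_diff_le) (auto intro: order.trans[OF degree_monom_le])
    fix z assume "z \<in> range (fls_const :: 'a \<Rightarrow> 'a fls)"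
    then obtain c where c: "z = fls_const c" by auto
    have "poly f z = (\<Prod>d\<in>(UNIV::'a set). z - fls_const d)" by (simp add: f_def poly_prod)
    also have "\<dots> = 0" using c by (intro prod_zero) auto
    finally show "poly f z = poly h z"
      using c finite_field_power_card[of c] by (simp add: h_def poly_monom flip: fls_const_power)
  qed
  then have *: "poly f (x / y) = poly h (x / y)" by simp
  have "(\<Prod>c\<in>UNIV. x - fls_const c * y) = (\<Prod>c\<in>(UNIV::'a set). y * (x / y - fls_const c))"
    using False by (intro prod.cong) (simp_all add: field_simps)
  also have "\<dots> = y ^ ?q * poly f (x / y)" by (simp add: prod.distrib f_def poly_prod)
  also have "\<dots> = y ^ ?q * ((x / y) ^ ?q - x / y)" by (simp only: * h_def) (simp add: poly_monom)
  also have "\<dots> = x ^ ?q - x * (y ^ ?q / y)" using False by (simp add: field_simps)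
  also have "y ^ ?q / y = y ^ (?q - 1)" using False q by (simp add: power_diff)
  finally show ?thesis .
qed

lemma prod_minus_nonzero_const_mult:
  fixes x y :: "'a::{field,finite} fls"
  assumes "x \<noteq> 0"
  shows "(\<Prod>c\<in>UNIV-{0}. x - fls_const c * y) = x ^ (CARD('a) - 1) - y ^ (CARD('a) - 1)"
proof -
  have q: "CARD('a) = Suc (CARD('a) - 1)" by (simp add: Suc_diff_Suc)
  have "x * (\<Prod>c\<in>UNIV-{0}. x - fls_const c * y) = (\<Prod>c\<in>(UNIV::'a set). x - fls_const c * y)"
    by (simp add: prod.remove[of UNIV 0])
  also have "\<dots> = x ^ Suc (CARD('a) - 1) - x * y ^ (CARD('a) - 1)"
    by (subst q[symmetric]) (rule prod_minus_const_mult)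
  also have "\<dots> = x * (x ^ (CARD('a) - 1) - y ^ (CARD('a) - 1))"
    by (simp only: power_Suc right_diff_distrib)
  finally show ?thesis using assms by simp
qed

text \<open>The values \<open>x\<close>, \<open>y\<close>, \<open>z\<close> will be
  \<open>T\<close>, \<open>T^q\<close>, \<open>T^(q^2)\<close>, and \<open>A\<close>,
  \<open>C\<close> will be \<open>q\<close>-th powers of \<open>\<alpha>\<close>, \<open>c1\<close>.
  The equations \<open>b\<close> and \<open>e\<close> come from the two recursions. Division by
  \<open>\<alpha>'\<close> turns both into equations in \<open>u = A / \<alpha>'\<close>, after
  which \<open>k\<close> and \<open>d2\<close> can be eliminated.\<close>

lemma two_recurrences_elim:
  fixes x y z :: "'k::field"
  assumes nz: "\<alpha>' \<noteq> 0"
    and b: "\<alpha>' = - \<beta> * \<alpha>" "\<alpha>' * d1 = A - \<beta> * (\<alpha> * c1)" "\<alpha>' * d2 = A * C - \<beta> * (\<alpha> * c2)"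
    and e: "x * \<alpha>' = - k * \<epsilon> * \<alpha>" "y * (\<alpha>' * d1) = k * (A - \<epsilon> * (\<alpha> * c1))"
      "z * (\<alpha>' * d2) = k * (A * C - \<epsilon> * (\<alpha> * c2))"
  shows "(z - x) * c2 = C * ((y - x) * c1 + (c1 - d1) * (z - y))"
proof -
  define u where "u = A / \<alpha>'"
  have A: "A = \<alpha>' * u" using nz by (simp add: u_def)
  have 1: "\<beta> * (\<alpha> * c) = - (\<alpha>' * c)" and 2: "k * (\<epsilon> * (\<alpha> * c)) = - (\<alpha>' * (x * c))" for c
  proof -
    show "\<beta> * (\<alpha> * c) = - (\<alpha>' * c)" unfolding b(1) by simp
    have "k * (\<epsilon> * (\<alpha> * c)) = - (- k * \<epsilon> * \<alpha>) * c" by (simp add: mult_ac)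
    also have "\<dots> = - (\<alpha>' * (x * c))" unfolding e(1)[symmetric] by (simp add: mult_ac)
    finally show "k * (\<epsilon> * (\<alpha> * c)) = - (\<alpha>' * (x * c))" .
  qed
  have "\<alpha>' * d1 = \<alpha>' * (u + c1)" unfolding b(2) A 1 by (simp add: algebra_simps)
  then have d1: "d1 = u + c1" using nz by simp
  have "\<alpha>' * d2 = \<alpha>' * (u * C + c2)" unfolding b(3) A 1 by (simp add: algebra_simps)
  then have d2: "d2 = u * C + c2" using nz by simp
  have "\<alpha>' * (y * d1) = \<alpha>' * (k * u + x * c1)"
    using e(2) unfolding right_diff_distrib 2 A by (simp add: algebra_simps)
  then have y: "y * d1 = k * u + x * c1" using nz by simp
  have "\<alpha>' * (z * d2) = \<alpha>' * (k * u * C + x * c2)"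
    using e(3) unfolding right_diff_distrib 2 A by (simp add: algebra_simps)
  then have z: "z * d2 = k * u * C + x * c2" using nz by simp
  have "(z - x) * c2 = z * d2 - x * c2 - C * (z * u)" unfolding d2 by (simp add: algebra_simps)
  also have "\<dots> = C * (k * u - z * u)" unfolding z by (simp add: algebra_simps)
  also have "k * u = y * d1 - x * c1" unfolding y by simp
  also have "u = d1 - c1" unfolding d1 by simp
  finally show ?thesis by (simp add: algebra_simps)
qed

section \<open>Frobenius, \<open>q\<close>-linear polynomials and the product over polynomials of
  bounded degree\<close>

locale finite_field_order =
  fixes ty :: "'a::{field,finite} itself" and p n q :: nat
  assumes prime_p: "prime p" and n_ge_1: "n \<ge> 1" and q_eq: "q = p ^ n" and card_eq: "CARD('a) = q"
begin

lemma char_eq: "CHAR('a) = p"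
proof -
  have "CHAR('a) > 0" by (rule finite_imp_CHAR_pos) simp
  then have "prime CHAR('a)" by (rule prime_CHAR_semidom)
  moreover have "CHAR('a) dvd p ^ n"
  proof -
    \<comment> \<open>Translation by \<open>1\<close> permutes the field but adds
      \<open>CARD('a)\<close> to the sum of its elements, so this number is zero in the
      field.\<close>
    have "(\<Sum>y\<in>UNIV. y) = (\<Sum>y\<in>(UNIV :: 'a set). y + 1)"
      by (rule sum.reindex_bij_witness[of _ "\<lambda>y. y + 1" "\<lambda>y. y - 1"]) auto
    then have "of_nat CARD('a) = (0 :: 'a)" by (simp add: sum.distrib)
    then show ?thesis by (simp add: of_nat_eq_0_iff_char_dvd card_eq flip: q_eq)
  qed
  ultimately show ?thesis using prime_p primes_dvd_imp_eq prime_dvd_power by blast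
qed

lemma q_gt_1: "q > 1"
  using card_field_gt_1[where ?'a = 'a] card_eq by simp

lemma frobenius_add_fls: "(x + y :: 'a fls) ^ (q ^ i) = x ^ (q ^ i) + y ^ (q ^ i)"
  using prime_p by (intro freshmans_dream'[where n = "n * i"]) (simp_all add: char_eq q_eq power_mult)

lemma fls_const_power_q: "(fls_const c :: 'a fls) ^ (q ^ i) = fls_const c"
proof (induction i)
  case (Suc i)
  have "(fls_const c :: 'a fls) ^ (q ^ Suc i) = (fls_const c ^ q) ^ (q ^ i)"
    by (simp flip: power_mult)
  also have "fls_const c ^ q = fls_const c"
    using finite_field_power_card[of c] card_eq by (simp flip: fls_const_power)
  finally show ?case using Suc by simp
qed simp

text \<open>Frobenius makes such polynomials linear over the constant field, as
  \<open>poly_q_linear_minus\<close> shows.\<close>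

definition q_linear :: "'a fls poly \<Rightarrow> bool" where
  "q_linear f \<longleftrightarrow> (\<forall>m. coeff f m \<noteq> 0 \<longrightarrow> (\<exists>i. m = q ^ i))"

lemma poly_q_linear_minus:
  assumes "q_linear f"
  shows "poly f (x - fls_const c * y) = poly f x - fls_const c * poly f y"
proof -
  have "coeff f m * (x - fls_const c * y) ^ m = coeff f m * x ^ m - fls_const c * (coeff f m * y ^ m)" for m
  proof (cases "coeff f m = 0")
    case False
    then obtain i where i: "m = q ^ i" using assms by (auto simp: q_linear_def)
    have "(x - fls_const c * y) ^ m = (x + fls_const (- c) * y) ^ m"
      by simp
    also have "\<dots> = x ^ m + fls_const (- c) * y ^ m"
      unfolding i frobenius_add_fls power_mult_distrib fls_const_power_q ..
    finally show ?thesis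
      by (simp add: right_diff_distrib mult.left_commute)
  qed simp
  then show ?thesis
    by (simp add: poly_altdef sum_subtractf sum_distrib_left)
qed

lemma poly_power_q: "f ^ q = (\<Sum>i\<le>degree f. monom (coeff f i ^ q) (i * q))" for f :: "'a fls poly"
proof -
  have "f ^ q = (\<Sum>i\<le>degree f. monom (coeff f i) i) ^ q" by (simp add: poly_as_sum_of_monoms)
  also have "\<dots> = (\<Sum>i\<le>degree f. monom (coeff f i) i ^ q)"
    using prime_p by (intro freshmans_dream_sum'[where n = n]) (simp_all add: char_eq q_eq)
  finally show ?thesis by (simp add: monom_power mult.commute)
qed

lemma coeff_power_q: "coeff (f ^ q) m = (if q dvd m then coeff f (m div q) ^ q else 0)"
  for f :: "'a fls poly"
proof (cases "q dvd m")
  case True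
  then obtain j where j: "m = q * j" by blast
  have q: "q > 0" using q_gt_1 by simp
  have "coeff (f ^ q) m = (\<Sum>i\<le>degree f. if i = j then coeff f i ^ q else 0)"
    using q by (simp add: poly_power_q coeff_sum j mult.commute)
  also have "\<dots> = coeff f j ^ q" using q by (auto simp: coeff_eq_0)
  finally show ?thesis using True q by (simp add: j)
next
  case False
  then show ?thesis by (auto simp: poly_power_q coeff_sum intro!: sum.neutral)
qed

lemma q_linear_power_q: "q_linear f \<Longrightarrow> q_linear (f ^ q)"
  unfolding q_linear_def coeff_power_q
proof (intro allI impI)
  fix m assume *: "\<forall>m. coeff f m \<noteq> 0 \<longrightarrow> (\<exists>i. m = q ^ i)"
    "(if q dvd m then coeff f (m div q) ^ q else 0) \<noteq> 0"
  then have "q dvd m" "coeff f (m div q) \<noteq> 0" using q_gt_1 by (auto split: if_splits)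
  with *(1) obtain i where "m div q = q ^ i" by blast
  with \<open>q dvd m\<close> have "m = q ^ Suc i" by (metis dvd_mult_div_cancel power_Suc)
  then show "\<exists>i. m = q ^ i" by blast
qed

lemma q_linear_diff_smult: "q_linear f \<Longrightarrow> q_linear g \<Longrightarrow> q_linear (f - smult c g)"
  unfolding q_linear_def coeff_diff coeff_smult by (metis diff_zero mult_zero_right)

text \<open>Carlitz's polynomial with the elements of \<open>polys D\<close> as roots. The recursive
  form makes \<open>q\<close>-linearity immediate; \<open>poly_E\<close> then recovers the
  product.\<close>

primrec E :: "nat \<Rightarrow> 'a fls poly" where
  "E 0 = [:0, 1:]"
| "E (Suc D) = E D ^ q - smult (poly (E D) (T_fls ^ D) ^ (q - 1)) (E D)"

lemma q_linear_E: "q_linear (E D)"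
proof (induction D)
  case 0
  have "coeff [:0, 1 :: 'a fls:] m \<noteq> 0 \<Longrightarrow> m = q ^ 0" for m
    by (auto simp: coeff_pCons split: nat.splits if_splits)
  then show ?case unfolding q_linear_def by (metis E.simps(1))
qed (simp add: q_linear_power_q q_linear_diff_smult)

text \<open>Grouping by the leading coefficient \<open>c\<close>, the inner product is
  \<open>E D\<close> at \<open>x - c T^D\<close>. By \<open>q\<close>-linearity this is linear in
  \<open>c\<close>, and the product over \<open>c\<close> is that of
  \<open>prod_minus_const_mult\<close>.\<close>

lemma poly_E: "poly (E D) x = (\<Prod>a\<in>polys D. x - poly_to_fls a)"
proof (induction D arbitrary: x)
  case (Suc D)
  have "(\<Prod>a\<in>polys (Suc D). x - poly_to_fls a)
      = (\<Prod>(c, a)\<in>UNIV \<times> polys D. x - poly_to_fls (monom c D + a))"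
    unfolding polys_Suc_eq_monom by (subst prod.reindex[OF inj_on_polys_monom]) (simp add: case_prod_unfold)
  also have "\<dots> = (\<Prod>c\<in>UNIV. \<Prod>a\<in>polys D. (x - fls_const c * T_fls ^ D) - poly_to_fls a)"
    by (subst prod.cartesian_product[symmetric])
      (simp add: poly_to_fls_add poly_to_fls_monom algebra_simps)
  also have "\<dots> = (\<Prod>c\<in>UNIV. poly (E D) x - fls_const c * poly (E D) (T_fls ^ D))"
    by (simp add: Suc.IH[symmetric] poly_q_linear_minus[OF q_linear_E])
  also have "\<dots> = poly (E (Suc D)) x"
    by (simp add: prod_minus_const_mult card_eq)
  finally show ?case by simp
qed simp

text \<open>Grouping by the constant coefficient instead:
  \<open>T x - (c + T a) = T ((x - c / T) - a)\<close>. The extracted factors \<open>T\<close>, one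
  for each element of \<open>polys (Suc D)\<close>, give the power in front.\<close>

lemma poly_E_Suc_T_mult:
  "poly (E (Suc D)) (T_fls * x)
    = T_fls ^ (q ^ Suc D) * (poly (E D) x ^ q - poly (E D) x * poly (E D) (1 / T_fls) ^ (q - 1))"
proof -
  define y where "y = 1 / (T_fls :: 'a fls)"
  have Ty: "T_fls * y = 1"
    unfolding y_def
    by (simp only: times_divide_eq_right mult_1_right divide_self[OF fls_X_inv_nonzero])
  have "poly (E (Suc D)) (T_fls * x) = (\<Prod>(c, a)\<in>UNIV \<times> polys D. T_fls * x - poly_to_fls (pCons c a))"
    unfolding poly_E polys_Suc_eq_pCons
    by (subst prod.reindex[OF inj_on_polys_pCons]) (simp add: case_prod_unfold)
  also have "\<dots> = (\<Prod>c\<in>UNIV. \<Prod>a\<in>polys D. T_fls * ((x - fls_const c * y) - poly_to_fls a))"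
    by (subst prod.cartesian_product[symmetric])
      (intro prod.cong refl, simp add: poly_to_fls_pCons algebra_simps Ty)
  also have "\<dots> = (\<Prod>c\<in>UNIV. T_fls ^ (q ^ D) * (poly (E D) x - fls_const c * poly (E D) y))"
    by (simp add: prod.distrib card_polys card_eq poly_E[symmetric] poly_q_linear_minus[OF q_linear_E])
  also have "\<dots> = (T_fls ^ (q ^ D)) ^ q *
      (poly (E D) x ^ q - poly (E D) x * poly (E D) y ^ (q - 1))"
    by (subst prod.distrib) (simp add: prod_minus_const_mult card_eq)
  finally show ?thesis by (simp add: mult.commute y_def flip: power_mult)
qed

section \<open>Coefficients of the product over monic polynomials\<close>

definition Y :: "'a poly \<Rightarrow> 'a fls" where
  "Y a = (1 / poly_to_fls a) ^ (q - 1)"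

definition F :: "nat \<Rightarrow> 'a fls poly" where
  "F D = (\<Prod>a\<in>monics D. [:1, - Y a:])"

lemma coeff_F_0 [simp]: "coeff (F D) 0 = 1"
  by (simp add: F_def poly_0_coeff_0[symmetric] poly_prod)

text \<open>The nonzero constant multiples of a monic \<open>a\<close> contribute
  \<open>x^(q-1) - a^(q-1)\<close>, which is \<open>- a^(q-1)\<close> times
  \<open>1 - Y a * x^(q-1)\<close>. The constant \<open>\<kappa>\<close> collects the first factors,
  with \<open>a\<close> read as its Laurent series.\<close>

lemma E_eq_F: "\<exists>\<kappa>. \<kappa> \<noteq> 0 \<and> E D = smult \<kappa> (monom 1 1 * pcompose (F D) (monom 1 (q - 1)))"
proof (intro exI conjI)
  define \<kappa> where "\<kappa> = (\<Prod>a\<in>monics D. - ((poly_to_fls a :: 'a fls) ^ (q - 1)))"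
  have nz: "a \<in> monics D \<Longrightarrow> poly_to_fls a \<noteq> 0" for a :: "'a poly"
    by (auto simp: monics_def)
  then show "\<kappa> \<noteq> 0" by (simp add: \<kappa>_def)
  show "E D = smult \<kappa> (monom 1 1 * pcompose (F D) (monom 1 (q - 1)))"
  proof (rule poly_eqI_cofinite[OF _ infinite_UNIV_fls])
    fix x :: "'a fls" assume x: "x \<noteq> 0"
    have "poly (E D) x = x * (\<Prod>a\<in>polys D - {0}. x - poly_to_fls a)"
      by (simp add: poly_E prod.remove[of "polys D" 0])
    also have "(\<Prod>a\<in>polys D - {0}. x - poly_to_fls a)
        = (\<Prod>(a, c)\<in>monics D \<times> (UNIV - {0}). x - poly_to_fls (smult c a))"
      unfolding polys_minus_0_eq
      by (subst prod.reindex[OF inj_on_monics_smult]) (simp add: case_prod_unfold)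
    also have "\<dots> = (\<Prod>a\<in>monics D. x ^ (q - 1) - poly_to_fls a ^ (q - 1))"
      by (subst prod.cartesian_product[symmetric])
        (simp add: poly_to_fls_smult prod_minus_nonzero_const_mult[OF x] card_eq)
    also have "\<dots> = (\<Prod>a\<in>monics D. - (poly_to_fls a ^ (q - 1)) * (1 - Y a * x ^ (q - 1)))"
      using nz by (intro prod.cong) (simp_all add: Y_def field_simps)
    also have "\<dots> = \<kappa> * poly (F D) (x ^ (q - 1))"
      by (simp only: prod.distrib) (simp add: \<kappa>_def F_def poly_prod mult.commute)
    finally show "poly (E D) x = poly (smult \<kappa> (monom 1 1 * pcompose (F D) (monom 1 (q - 1)))) x"
      by (simp add: poly_pcompose poly_monom mult_ac)
  qed
qed

lemma coeff_E: "coeff (E D) 1 \<noteq> 0" "coeff (E D) (1 + (q - 1) * j) = coeff (E D) 1 * coeff (F D) j"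
proof -
  obtain \<kappa> where \<kappa>: "\<kappa> \<noteq> 0" "E D = smult \<kappa> (monom 1 1 * pcompose (F D) (monom 1 (q - 1)))"
    using E_eq_F by blast
  have *: "coeff (E D) (1 + (q - 1) * j) = \<kappa> * coeff (F D) j" for j
    using q_gt_1 by (simp add: \<kappa>(2) coeff_monom_mult coeff_pcompose_monom)
  from *[of 0] have 1: "coeff (E D) 1 = \<kappa>" by simp
  then show "coeff (E D) 1 \<noteq> 0" using \<kappa> by simp
  show "coeff (E D) (1 + (q - 1) * j) = coeff (E D) 1 * coeff (F D) j"
    using 1 * by simp
qed

lemma coeff_F_eq_0:
  assumes "\<And>i. 1 + (q - 1) * j \<noteq> q ^ i"
  shows "coeff (F D) j = 0"
  using coeff_E[of D] q_linear_E[of D] assms unfolding q_linear_def by (metis mult_eq_0_iff)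

lemma coeff_F_q_plus_1: "coeff (E D) (q ^ 2) = coeff (E D) 1 * coeff (F D) (q + 1)"
proof -
  have "1 + (q - 1) * (q + 1) = q ^ 2"
    using q_gt_1 by (cases q) (simp_all add: power2_eq_square)
  with coeff_E(2)[of D "q + 1"] show ?thesis by simp
qed

lemma coeff_F_1: "coeff (E D) q = coeff (E D) 1 * coeff (F D) 1"
  using coeff_E(2)[of D 1] q_gt_1 by simp

text \<open>By \<open>q\<close>-linearity of \<open>E D\<close> a coefficient of \<open>F D\<close>
  survives only if \<open>1 + (q - 1) * j\<close> is a power of \<open>q\<close>. For
  \<open>j\<close> equal to \<open>0\<close>, \<open>1\<close>, \<open>q + 1\<close> these are
  \<open>1\<close>, \<open>q\<close>, \<open>q^2\<close>, and the bound \<open>j \<le> 2 * q\<close>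
  stays below \<open>q^3\<close>.\<close>

lemma coeff_F_small:
  assumes "2 \<le> j" "j \<le> 2 * q" "j \<noteq> q + 1"
  shows "coeff (F D) j = 0"
proof (rule coeff_F_eq_0)
  fix i
  have q: "q \<ge> 2" using q_gt_1 by simp
  let ?m = "1 + (q - 1) * j"
  have lo: "q < ?m"
  proof -
    have "(q - 1) * 2 \<le> (q - 1) * j" using assms by (intro mult_le_mono2) simp
    moreover have "q < 1 + (q - 1) * 2" using q by simp
    ultimately show ?thesis by linarith
  qed
  have hi: "?m < q ^ 3"
  proof -
    have "(q - 1) * j \<le> (q - 1) * (2 * q)" using assms by simp
    moreover have "1 + (q - 1) * (2 * q) < q ^ 3"
    proof -
      obtain r where r: "q = r + 2" using q by (metis add.commute le_Suc_ex)
      show ?thesis unfolding r by (simp add: power3_eq_cube algebra_simps)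
    qed
    ultimately show ?thesis by linarith
  qed
  have ne: "?m \<noteq> q ^ 2"
  proof
    assume "?m = q ^ 2"
    moreover have "1 + (q - 1) * (q + 1) = q ^ 2"
      using q_gt_1 by (cases q) (simp_all add: power2_eq_square)
    ultimately have "(q - 1) * j = (q - 1) * (q + 1)" by linarith
    then show False using q assms(3) unfolding mult_cancel1 by simp
  qed
  show "?m \<noteq> q ^ i"
  proof
    assume m: "?m = q ^ i"
    have "q ^ 1 < q ^ i" using lo m by simp
    then have "1 < i" using q_gt_1 power_less_imp_less_exp by blast
    moreover have "i < 3" using hi m q_gt_1 power_less_imp_less_exp by metis
    ultimately have "i = 2" by simp
    with m ne show False by simp
  qed
qed

text \<open>
  Eliminates between the two ways of passing from degree \<open>D\<close> to \<open>D + 1\<close>: adding a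
  leading term, and multiplying by \<open>T\<close> and adding a constant term.
\<close>

lemma coeff_F_relation:
  "(T_fls ^ (q ^ 2) - T_fls) * coeff (F D) (q + 1) = coeff (F D) 1 ^ q *
    ((T_fls ^ q - T_fls) * coeff (F D) 1
      + (coeff (F D) 1 - coeff (F (Suc D)) 1) * (T_fls ^ (q ^ 2) - T_fls ^ q))"
proof -
  let ?T = "T_fls :: 'a fls"
  define \<beta> where "\<beta> = poly (E D) (?T ^ D) ^ (q - 1)"
  define \<epsilon> where "\<epsilon> = poly (E D) (1 / ?T) ^ (q - 1)"
  define \<alpha> where "\<alpha> = coeff (E D) 1"
  define \<alpha>' where "\<alpha>' = coeff (E (Suc D)) 1"
  define c1 where "c1 = coeff (F D) 1"
  define c2 where "c2 = coeff (F D) (q + 1)"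
  define d1 where "d1 = coeff (F (Suc D)) 1"
  define d2 where "d2 = coeff (F (Suc D)) (q + 1)"
  define k where "k = ?T ^ (q ^ Suc D)"
  have q: "q > 1" "q > 0" "\<not> q dvd 1" "q ^ 2 div q = q" using q_gt_1 by (auto simp: power2_eq_square)
  have nz: "\<alpha> \<noteq> 0" "\<alpha>' \<noteq> 0" "k \<noteq> 0" "?T \<noteq> 0"
    unfolding \<alpha>_def \<alpha>'_def k_def using coeff_E(1)[of D] coeff_E(1)[of "Suc D"]
    by (simp_all del: E.simps)
  \<comment> \<open>This is read off at \<open>1\<close>, \<open>q\<close> and \<open>q^2\<close>.
    The \<open>q\<close>-th power contributes nothing at \<open>1\<close>, and at the other two
    exponents the \<open>q\<close>-th powers of the coefficients at \<open>1\<close> and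
    \<open>q\<close>.\<close>
  have E_Suc: "coeff (E (Suc D)) m = coeff (E D ^ q) m - \<beta> * coeff (E D) m" for m
    by (simp add: \<beta>_def)
  have b0: "\<alpha>' = - \<beta> * \<alpha>" using E_Suc[of 1] q by (simp add: coeff_power_q \<alpha>_def \<alpha>'_def del: E.simps)
  have b1: "\<alpha>' * d1 = \<alpha> ^ q - \<beta> * (\<alpha> * c1)"
    using E_Suc[of q] q by (simp add: coeff_power_q coeff_F_1 \<alpha>_def \<alpha>'_def c1_def d1_def del: E.simps)
  have b2: "\<alpha>' * d2 = (\<alpha> * c1) ^ q - \<beta> * (\<alpha> * c2)"
    using E_Suc[of "q ^ 2"] q
    by (simp add: coeff_power_q coeff_F_1 coeff_F_q_plus_1 \<alpha>_def \<alpha>'_def c1_def c2_def d2_def del: E.simps)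
  \<comment> \<open>The second recursion holds at every nonzero point of an infinite field, hence as
    polynomials. Substituting \<open>T x\<close> for \<open>x\<close> then multiplies the
    coefficient at \<open>m\<close> by \<open>T^m\<close>.\<close>
  have "pcompose (E (Suc D)) [:0, ?T:] = smult k (E D ^ q - smult \<epsilon> (E D))"
    by (rule poly_eqI_cofinite[OF _ infinite_UNIV_fls])
      (simp add: poly_pcompose poly_E_Suc_T_mult mult.commute[of _ T_fls] k_def \<epsilon>_def mult.commute[of _ "_ ^ (q - 1)"]
        del: E.simps)
  then have E_T: "?T ^ m * coeff (E (Suc D)) m = k * (coeff (E D ^ q) m - \<epsilon> * coeff (E D) m)" for m
    by (metis coeff_pcompose_linear coeff_smult coeff_diff)
  have e0: "?T * \<alpha>' = - k * \<epsilon> * \<alpha>" using E_T[of 1] q by (simp add: coeff_power_q \<alpha>_def \<alpha>'_def del: E.simps)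
  have e1: "?T ^ q * (\<alpha>' * d1) = k * (\<alpha> ^ q - \<epsilon> * (\<alpha> * c1))"
    using E_T[of q] q by (simp add: coeff_power_q coeff_F_1 \<alpha>_def \<alpha>'_def c1_def d1_def del: E.simps)
  have e2: "?T ^ (q ^ 2) * (\<alpha>' * d2) = k * ((\<alpha> * c1) ^ q - \<epsilon> * (\<alpha> * c2))"
    using E_T[of "q ^ 2"] q
    by (simp add: coeff_power_q coeff_F_1 coeff_F_q_plus_1 \<alpha>_def \<alpha>'_def c1_def c2_def d2_def del: E.simps)
  have "(?T ^ (q ^ 2) - ?T) * c2 = c1 ^ q *
    ((?T ^ q - ?T) * c1 + (c1 - d1) * (?T ^ (q ^ 2) - ?T ^ q))"
    by (rule two_recurrences_elim[OF nz(2) b0 b1 b2[unfolded power_mult_distrib]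
          e0 e1 e2[unfolded power_mult_distrib]])
  then show ?thesis by (simp only: c1_def c2_def d1_def)
qed

end

section \<open>Valuations and the Euler product\<close>

text \<open>The case \<open>f = 0\<close> is separate because the library gives \<open>0\<close> the
  subdegree \<open>0\<close>, not infinity.\<close>

definition small :: "nat \<Rightarrow> 'a::field fls \<Rightarrow> bool" where
  "small N f \<longleftrightarrow> f = 0 \<or> int N \<le> fls_subdegree f"

lemma small_0 [simp]: "small N 0"
  by (simp add: small_def)

lemma small_mono: "small N f \<Longrightarrow> M \<le> N \<Longrightarrow> small M f"
  by (auto simp: small_def)

lemma small_add: "small N f \<Longrightarrow> small N g \<Longrightarrow> small N (f + g)"
  using fls_plus_subdegree[of f g] by (cases "f + g = 0") (auto simp: small_def)

lemma small_uminus: "small N (- f) \<longleftrightarrow> small N f"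
  by (simp add: small_def)

lemma small_diff: "small N f \<Longrightarrow> small N g \<Longrightarrow> small N (f - g)"
  using small_add[of N f "- g"] by (simp add: small_uminus)

lemma small_sum: "(\<And>i. i \<in> A \<Longrightarrow> small N (f i)) \<Longrightarrow> small N (sum f A)"
  by (induction A rule: infinite_finite_induct) (auto intro: small_add)

lemma small_sum_list: "(\<And>x. x \<in> set xs \<Longrightarrow> small N x) \<Longrightarrow> small N (sum_list xs)"
  by (induction xs) (auto intro: small_add)

lemma small_mult: "small M f \<Longrightarrow> small N g \<Longrightarrow> small (M + N) (f * g)"
  by (cases "f = 0 \<or> g = 0") (auto simp: small_def)

lemma small_mult_left: "small 0 f \<Longrightarrow> small N g \<Longrightarrow> small N (f * g)"
  using small_mult[of 0 f N g] by simp

lemma small_mult_right: "small N f \<Longrightarrow> small 0 g \<Longrightarrow> small N (f * g)"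
  using small_mult[of N f 0 g] by simp

lemma small_power: "small N f \<Longrightarrow> small (N * m) (f ^ m)"
proof (induction m)
  case 0
  then show ?case by (simp add: small_def)
next
  case (Suc m)
  then show ?case using small_mult[of N f "N * m" "f ^ m"] by simp
qed

lemma small_power_0: "small 0 f \<Longrightarrow> small 0 (f ^ m)"
  using small_power[of 0 f m] by simp

lemma small_of_nat: "small 0 (of_nat n)"
  by (simp add: small_def)

lemma small_of_int: "small 0 (of_int n)"
  by (simp add: small_def)

lemma small_1 [simp]: "small 0 1"
  by (simp add: small_def)

definition fls_unit :: "'a::field fls \<Rightarrow> bool" where
  "fls_unit f \<longleftrightarrow> f \<noteq> 0 \<and> fls_subdegree f = 0"

lemma fls_unit_nonzero: "fls_unit f \<Longrightarrow> f \<noteq> 0"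
  by (simp add: fls_unit_def)

lemma fls_unit_mult: "fls_unit f \<Longrightarrow> fls_unit g \<Longrightarrow> fls_unit (f * g)"
  by (simp add: fls_unit_def)

lemma fls_unit_power: "fls_unit f \<Longrightarrow> fls_unit (f ^ n)"
  by (simp add: fls_unit_def fls_subdegree_pow)

lemma fls_unit_uminus: "fls_unit (- f) \<longleftrightarrow> fls_unit f"
  by (simp add: fls_unit_def)

lemma small_divide: "small N f \<Longrightarrow> fls_unit g \<Longrightarrow> small N (f / g)"
  by (cases "f = 0") (auto simp: small_def fls_unit_def divide_inverse)

lemma fls_unit_1_plus:
  assumes "small 1 f"
  shows "fls_unit (1 + f)"
proof (cases "f = 0")
  case False
  have "fls_subdegree (1 + f) = fls_subdegree (1 :: 'a fls)"
    by (rule fls_subdegree_add_eq1[of 1 f]) (use assms False in \<open>auto simp: small_def\<close>)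
  \<comment> \<open>Subdegree \<open>0\<close> alone would not exclude the zero series, so a nonzero
    coefficient is exhibited.\<close>
  moreover have "fls_nth (1 + f) 0 \<noteq> 0"
    using assms False by (simp add: small_def)
  then have "1 + f \<noteq> 0" by force
  ultimately show ?thesis by (simp add: fls_unit_def)
qed (simp add: fls_unit_def)

lemma fls_unit_1_minus: "small 1 f \<Longrightarrow> fls_unit (1 - f)"
  using fls_unit_1_plus[of "- f"] by (simp add: small_uminus)

lemma small_power_diff:
  assumes "small N (f - g)" "small 0 f" "small 0 g"
  shows "small N (f ^ m - g ^ m)"
  unfolding power_diff_sumr2
  by (intro small_mult_right small_sum small_mult_left small_power_0 assms)

lemma small_divide_diff:
  assumes "small N (a - b)" "small N (c - d)" "small 0 b" "fls_unit c" "fls_unit d"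
  shows "small N (a / c - b / d)"
proof -
  have "a / c - b / d = (a - b) / c - b * (c - d) / (c * d)"
    using assms(4,5)[THEN fls_unit_nonzero] by (simp add: field_simps)
  then show ?thesis
    using assms by (auto intro!: small_diff small_divide small_mult_left fls_unit_mult)
qed

lemma dist_fls_le_of_small:
  assumes "small N (f - g)"
  shows "dist f g \<le> inverse (2 ^ N)"
proof (cases "f = g")
  case False
  with assms have "int N \<le> fls_subdegree (f - g)" by (simp add: small_def)
  then have "N \<le> nat (fls_subdegree (f - g))" "0 \<le> fls_subdegree (f - g)" by linarith+
  with False show ?thesis by (simp add: dist_fls_def)
qed simp

section \<open>Estimates for \<open>G\<close> and for the carry\<close>

lemma small_poly_of_int: "small 0 x \<Longrightarrow> small 0 (poly (map_poly of_int f) x)"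
  by (induction f) (auto simp: map_poly_pCons intro!: small_add small_mult_left small_of_int)

lemma coeff_G_numerator_0:
  assumes "prime p"
  shows "coeff (G_numerator p) 0 = 0"
proof -
  have p: "p > 0" using prime_gt_0_nat[OF assms] .
  have "int p * coeff (G_numerator p) 0 = coeff (smult (int p) (G_numerator p)) 0" by simp
  also have "\<dots> = 0"
    unfolding G_numerator_exact[OF assms] using p
    by (simp add: poly_0_coeff_0[symmetric] poly_monom power_0_left)
  finally show ?thesis using p by simp
qed

text \<open>The numerator of \<open>G\<close> has no constant term, so a factor \<open>x\<close>
  splits off, and the denominator is a unit.\<close>

lemma small_G:
  assumes "prime p" "small M x" "M \<ge> 1"
  shows "small M (G p x)"
proof -
  obtain a f where af: "G_numerator p = pCons a f" by (cases "G_numerator p")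
  with coeff_G_numerator_0[OF assms(1)] have "a = 0" by simp
  have x: "small 0 x" "small 1 x" using assms(2,3) by (auto intro: small_mono)
  have "small M (x * poly (map_poly of_int f) x)"
    by (intro small_mult_right assms small_poly_of_int x)
  then show ?thesis
    unfolding G_def af \<open>a = 0\<close>
    by (intro small_divide fls_unit_power fls_unit_1_minus x) (simp add: map_poly_pCons)
qed

lemma small_carry: "(\<And>x. x \<in> set xs \<Longrightarrow> small 0 x) \<Longrightarrow> small 0 (carry p xs)"
  by (induction xs)
    (auto intro!: small_add small_sum small_mult_left small_power_0 small_of_nat small_sum_list)

text \<open>Every term that the recursion adds for a new head contains a positive power of it, and
  the other factors are integral. This makes truncating a family at a degree bound harmless.\<close>

lemma small_carry_append:
  assumes "\<And>x. x \<in> set xs \<Longrightarrow> small N x" "\<And>x. x \<in> set ys \<Longrightarrow> small 0 x"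
  shows "small N (carry p (xs @ ys) - carry p ys)"
  using assms
proof (induction xs)
  case (Cons x xs)
  have s: "small 0 (sum_list (xs @ ys))"
    using Cons.prems by (intro small_sum_list) (auto intro: small_mono)
  have x: "small N (x ^ i)" if "i \<ge> 1" for i
    using small_power[of N x i] Cons.prems that by (auto intro: small_mono)
  have "small N (\<Sum>i\<in>{1..<p}. of_nat ((p choose i) div p) * x ^ i * sum_list (xs @ ys) ^ (p - i))"
    by (intro small_sum small_mult_right small_mult_left small_of_nat small_power_0 s x) simp
  moreover have "small N (carry p (xs @ ys) - carry p ys)" using Cons by auto
  ultimately show ?case using small_add by (fastforce simp: algebra_simps)
qed simp

section \<open>Reciprocal powers and monic irreducible polynomials\<close>

definition rpow :: "nat \<Rightarrow> 'a::field poly \<Rightarrow> 'a fls" where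
  "rpow k a = 1 / poly_to_fls a ^ k"

lemma rpow_mult: "rpow k (a * b) = rpow k a * rpow k b"
  by (simp add: rpow_def poly_to_fls_mult power_mult_distrib)

lemma rpow_1 [simp]: "rpow k 1 = 1"
  by (simp add: rpow_def)

lemma rpow_power: "rpow k (a ^ i) = rpow k a ^ i"
  by (induction i) (simp_all add: rpow_mult)

lemma small_rpow:
  assumes "M \<le> k * degree a"
  shows "small M (rpow k a)"
proof (cases "rpow k a = 0")
  case False
  have "int M \<le> int k * int (degree a)"
    using assms by (metis of_nat_le_iff of_nat_mult)
  then show ?thesis
    by (simp add: small_def rpow_def divide_inverse fls_subdegree_pow)
qed simp

lemma monic_degree_0: "lead_coeff a = 1 \<Longrightarrow> degree a = 0 \<Longrightarrow> (a :: 'a::field poly) = 1"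
  by (metis degree_eq_zeroE lead_coeff_pCons(2) one_pCons pCons_0_0 degree_pCons_0 coeff_pCons_0)

text \<open>The polynomial \<open>1\<close> contributes \<open>1\<close>; all other monic
  polynomials have positive degree, hence contribute terms of positive valuation.\<close>

lemma fls_unit_sum_rpow:
  fixes as :: "'a::field poly list"
  assumes "k \<ge> 1" "distinct as" "1 \<in> set as" "\<And>a. a \<in> set as \<Longrightarrow> lead_coeff a = 1"
  shows "fls_unit (\<Sum>a\<leftarrow>as. rpow k a)"
proof -
  have "(\<Sum>a\<leftarrow>as. rpow k a) = (\<Sum>a\<in>set as. rpow k a)"
    using assms(2) by (simp add: sum_list_distinct_conv_sum_set)
  also have "\<dots> = 1 + (\<Sum>a\<in>set as - {1}. rpow k a)"
    using assms(3) by (simp add: sum.remove[of _ 1])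
  finally have *: "(\<Sum>a\<leftarrow>as. rpow k a) = 1 + (\<Sum>a\<in>set as - {1}. rpow k a)" .
  show ?thesis unfolding *
  proof (intro fls_unit_1_plus small_sum small_rpow)
    fix a assume "a \<in> set as - {1}"
    then have "degree a > 0" using monic_degree_0 assms(4) by fastforce
    then show "1 \<le> k * degree a" using assms(1) by simp
  qed
qed

lemma exists_monic_irreducible_divisor:
  fixes a :: "'a::field poly"
  assumes "degree a > 0"
  shows "\<exists>P\<in>monic_irreducibles. P dvd a"
  using assms
proof (induction "degree a" arbitrary: a rule: less_induct)
  case less
  show ?case
  proof (cases "irreducible a")
    case True
    define c where "c = inverse (lead_coeff a)"
    have c: "c \<noteq> 0" using less.prems by (auto simp: c_def)
    have "irreducible (smult c a)"
    proof -
      have "is_unit [:c:]" using c by (simp add: is_unit_const_poly_iff dvd_field_iff)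
      then have "irreducible ([:c:] * a)" using True irreducible_mult_unit_left by blast
      then show ?thesis by simp
    qed
    moreover have "lead_coeff (smult c a) = 1" using less.prems by (auto simp: c_def)
    moreover have "smult c a dvd a" using c by (simp add: smult_dvd)
    ultimately show ?thesis unfolding monic_irreducibles_def by blast
  next
    case False
    have a0: "a \<noteq> 0" using less.prems by auto
    have "\<not> is_unit a" using less.prems by (auto simp: is_unit_iff_degree[OF a0])
    with False a0 obtain b c where bc: "a = b * c" "\<not> is_unit b" "\<not> is_unit c"
      unfolding irreducible_def by blast
    with a0 have "b \<noteq> 0" "c \<noteq> 0" by auto
    with bc have "degree b > 0" "degree c > 0" by (auto simp: is_unit_iff_degree)
    moreover from bc \<open>b \<noteq> 0\<close> \<open>c \<noteq> 0\<close> have "degree a = degree b + degree c" by (simp add: degree_mult_eq)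
    ultimately obtain P where "P \<in> monic_irreducibles" "P dvd b" using less.hyps[of b] by auto
    then show ?thesis unfolding bc(1) using dvd_mult2 by blast
  qed
qed

lemma monic_irreducible_not_dvd_1: "P \<in> monic_irreducibles \<Longrightarrow> \<not> P dvd 1"
  by (auto simp: monic_irreducibles_def irreducible_def)

lemma monic_irreducible_degree:
  assumes "P \<in> monic_irreducibles"
  shows "degree P > 0"
proof (rule ccontr)
  assume "\<not> degree P > 0"
  with assms have "P = 1" by (intro monic_degree_0) (auto simp: monic_irreducibles_def)
  with monic_irreducible_not_dvd_1[OF assms] show False by simp
qed

lemma monic_irreducible_dvd_imp_eq:
  assumes "P \<in> monic_irreducibles" "Q \<in> monic_irreducibles" "P dvd Q"
  shows "P = Q"
proof -
  from assms(3) obtain R where R: "Q = P * R" by blast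
  have "\<not> is_unit P" "irreducible Q" using assms by (auto simp: monic_irreducibles_def irreducible_def)
  with R have "is_unit R" using irreducibleD by blast
  moreover have "lead_coeff R = 1"
    using R assms(1,2) by (auto simp: monic_irreducibles_def lead_coeff_mult)
  ultimately have "R = 1"
    using monic_degree_0[of R] is_unit_iff_degree[of R] by fastforce
  with R show ?thesis by simp
qed

lemma monic_irreducible_dvd_mult:
  assumes "P \<in> monic_irreducibles" "P dvd a * b"
  shows "P dvd a \<or> P dvd b"
proof -
  have "prime_elem P" using assms(1) by (intro field_poly_irreducible_imp_prime) (simp add: monic_irreducibles_def)
  with assms(2) show ?thesis by (simp add: prime_elem_dvd_mult_iff)
qed

lemma set_list_times: "set (list_times xs ys) = (\<lambda>(x, y). x * y) ` (set xs \<times> set ys)"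
  by (induction xs) auto

lemma distinct_list_times:
  assumes "distinct xs" "distinct ys" "inj_on (\<lambda>(x, y). x * y) (set xs \<times> set ys)"
  shows "distinct (list_times xs ys)"
  using assms(1,3)
proof (induction xs)
  case (Cons x xs)
  have inj: "u = u'" "v = v'" if "u * v = u' * v'" "u \<in> set (x # xs)" "u' \<in> set (x # xs)"
    "v \<in> set ys" "v' \<in> set ys" for u u' v v'
    using inj_onD[OF Cons.prems(2), of "(u, v)" "(u', v')"] that by auto
  have "distinct (map ((*) x) ys)"
    using assms(2) inj(2)[of x _ x] by (auto simp: distinct_map intro!: inj_onI)
  moreover have "distinct (list_times xs ys)"
    using Cons.prems by (intro Cons.IH) (auto elim: inj_on_subset)
  moreover have "set (map ((*) x) ys) \<inter> set (list_times xs ys) = {}"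
    using Cons.prems(1) inj(1) by (fastforce simp: set_list_times)
  ultimately show ?case by simp
qed simp

section \<open>The Euler product for the carry\<close>

lemma sum_list_power_char:
  fixes xs :: "'r::comm_ring_1 list"
  assumes "prime p" "CHAR('r) = p"
  shows "(\<Sum>x\<leftarrow>xs. x ^ p) = sum_list xs ^ p"
proof (induction xs)
  case Nil
  then show ?case using prime_gt_0_nat[OF assms(1)] by (simp add: power_0_left)
next
  case (Cons x xs)
  have "(x + sum_list xs) ^ p = x ^ p + sum_list xs ^ p"
    by (rule freshmans_dream) (simp_all add: assms)
  with Cons show ?case by simp
qed

text \<open>In characteristic \<open>p\<close> the sum of \<open>p\<close>-th powers in
  \<open>carry_geometric\<close> is the \<open>p\<close>-th power of the geometric sum. Dividing by
  it also turns \<open>(1 - x)^p\<close> into \<open>(1 - x^N)^p\<close> under the boundary term,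
  which thereby becomes a value of \<open>G\<close>.\<close>

lemma carry_geometric_divide:
  fixes x :: "'a::field fls"
  assumes p: "prime p" "CHAR('a) = p" and x: "small 1 x" and N: "N \<ge> 1"
  shows "carry p (map ((^) x) [0..<N]) / (\<Sum>i\<leftarrow>[0..<N]. x ^ i) ^ p = G p x - G p (x ^ N)"
    and "(\<Sum>i\<leftarrow>[0..<N]. x ^ i) \<noteq> 0"
proof -
  define s where "s = (\<Sum>i\<leftarrow>[0..<N]. x ^ i)"
  define g where "g = (\<lambda>x::'a fls. poly (map_poly of_int (G_numerator p)) x)"
  have geo: "(1 - x) * s = 1 - x ^ N"
    by (simp add: s_def one_diff_power_eq lessThan_atLeast0 interv_sum_list_conv_sum_set_nat)
  have xN: "small 1 (x ^ N)" using small_power[OF x, of N] N by (auto intro: small_mono)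
  have nz: "1 - x \<noteq> 0" "1 - x ^ N \<noteq> 0"
    using fls_unit_1_minus[OF x] fls_unit_1_minus[OF xN] fls_unit_nonzero by blast+
  with geo show s0: "(\<Sum>i\<leftarrow>[0..<N]. x ^ i) \<noteq> 0" by (auto simp: s_def)
  have geo_p: "(1 - x) ^ p * s ^ p = (1 - x ^ N) ^ p"
    using geo by (simp flip: power_mult_distrib)
  have "(1 - x) ^ p * carry p (map ((^) x) [0..<N]) = g x * s ^ p - g (x ^ N)"
    using carry_geometric[OF p(1), of x N] sum_list_power_char[of p "map ((^) x) [0..<N]"] p
    by (simp add: g_def s_def o_def)
  then have "carry p (map ((^) x) [0..<N]) = (g x * s ^ p - g (x ^ N)) / (1 - x) ^ p"
    using nz by (simp add: field_simps)
  then have "carry p (map ((^) x) [0..<N]) / s ^ p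
      = g x / (1 - x) ^ p - g (x ^ N) / ((1 - x) ^ p * s ^ p)"
    using s0 nz by (simp add: s_def[symmetric] field_simps)
  then show "carry p (map ((^) x) [0..<N]) / (\<Sum>i\<leftarrow>[0..<N]. x ^ i) ^ p = G p x - G p (x ^ N)"
    unfolding geo_p by (simp add: s_def g_def G_def)
qed

text \<open>Two different exponents of \<open>P\<close> would force \<open>P\<close> to divide an
  element of \<open>A\<close>.\<close>

lemma inj_on_prime_power_mult:
  fixes P :: "'a::field poly"
  assumes "P \<in> monic_irreducibles" "\<And>a. a \<in> A \<Longrightarrow> \<not> P dvd a"
  shows "inj_on (\<lambda>(x, y). x * y) (((^) P ` I) \<times> A)"
proof -
  have P: "P \<noteq> 0" using monic_irreducible_degree[OF assms(1)] by auto
  have *: "i \<ge> j" if "P ^ i * a = P ^ j * b" "a \<in> A" for i j a b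
  proof (rule ccontr)
    assume "\<not> i \<ge> j"
    then obtain d where "j = i + Suc d" by (metis less_imp_Suc_add not_le add_Suc_right)
    with that P have "a = P * (P ^ d * b)" by (simp add: power_add mult_ac)
    then show False using assms(2)[OF that(2)] by (metis dvd_triv_left)
  qed
  show ?thesis
  proof (rule inj_onI, clarify)
    fix i j a b assume "a \<in> A" "b \<in> A" "P ^ i * a = P ^ j * b"
    with *[of i a j b] *[of j b i a] P show "P ^ i = P ^ j \<and> a = b" by fastforce
  qed
qed

lemma distinct_map_power:
  assumes "P \<in> monic_irreducibles"
  shows "distinct (map ((^) P) [0..<N])"
proof -
  have "inj ((^) P)"
  proof (rule injI)
    fix i j assume "P ^ i = P ^ j"
    then have "i * degree P = j * degree P"
      using degree_power_eq[of P] monic_irreducible_degree[OF assms] by (metis degree_0 less_irrefl)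
    then show "i = j" using monic_irreducible_degree[OF assms] by simp
  qed
  then show ?thesis by (auto simp: distinct_map intro: inj_on_subset)
qed

lemma dvd_monic_irreducible_power_imp_eq:
  "P \<in> monic_irreducibles \<Longrightarrow> Q \<in> monic_irreducibles \<Longrightarrow> Q dvd P ^ i \<Longrightarrow> Q = P"
proof (induction i)
  case 0
  then show ?case by (auto simp: monic_irreducibles_def irreducible_def)
next
  case (Suc i)
  then show ?case using monic_irreducible_dvd_mult[of Q P "P ^ i"] monic_irreducible_dvd_imp_eq by auto
qed

text \<open>The last bound is what the truncation needs: if \<open>degree a < N\<close>, the
  exponent of \<open>P\<close> is below \<open>N\<close> as well.\<close>

lemma extract_prime_power:
  fixes a :: "'a::field poly"
  assumes "P \<in> monic_irreducibles" "lead_coeff a = 1"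
  shows "\<exists>i b. a = P ^ i * b \<and> \<not> P dvd b \<and> lead_coeff b = 1 \<and> i + degree b \<le> degree a"
  using assms(2)
proof (induction "degree a" arbitrary: a rule: less_induct)
  case less
  show ?case
  proof (cases "P dvd a")
    case False
    then show ?thesis using less.prems by (intro exI[of _ 0] exI[of _ a]) simp
  next
    case True
    then obtain c where c: "a = P * c" by blast
    have P: "degree P > 0" "lead_coeff P = 1"
      using assms(1) monic_irreducible_degree by (auto simp: monic_irreducibles_def)
    have lc: "lead_coeff c = 1" using less.prems P c by (simp add: lead_coeff_mult)
    then have "P \<noteq> 0" "c \<noteq> 0" using P by auto
    then have deg: "degree a = degree P + degree c" using c by (simp add: degree_mult_eq)
    then obtain i b where "c = P ^ i * b" "\<not> P dvd b" "lead_coeff b = 1" "i + degree b \<le> degree c"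
      using less.hyps[of c] lc P by auto
    then show ?thesis using c deg P by (intro exI[of _ "Suc i"] exI[of _ b]) auto
  qed
qed

text \<open>The list consists of the products of powers \<open>P^i\<close>, \<open>i < N\<close>,
  over \<open>P\<close> in \<open>F\<close>. A new prime multiplies the family by its own powers,
  all products being distinct by unique factorization, and the additivity of the carry quotient adds
  one term to the sum. Only the properties of the list that survive this induction are
  recorded.\<close>

lemma euler_product_carry:
  fixes F :: "'a::field poly set"
  assumes p: "prime p" "CHAR('a) = p" and k: "k \<ge> 1" and N: "N \<ge> 1"
    and F: "finite F" "F \<subseteq> monic_irreducibles"
  shows "\<exists>as. distinct as
    \<and> (\<forall>a\<in>set as. lead_coeff a = 1 \<and> (\<forall>P\<in>monic_irreducibles. P dvd a \<longrightarrow> P \<in> F))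
    \<and> (\<forall>a. lead_coeff a = 1 \<and> degree a < N \<and> (\<forall>P\<in>monic_irreducibles. P dvd a \<longrightarrow> P \<in> F) \<longrightarrow> a \<in> set as)
    \<and> carry p (map (rpow k) as) / (\<Sum>a\<leftarrow>as. rpow k a) ^ p
      = (\<Sum>P\<in>F. G p (rpow k P) - G p (rpow k P ^ N))"
  using F
proof (induction F rule: finite_induct)
  case empty
  have "a = 1" if "lead_coeff a = 1" "\<forall>P\<in>monic_irreducibles. \<not> P dvd a" for a :: "'a poly"
    using that exists_monic_irreducible_divisor[of a] monic_degree_0[of a] by blast
  moreover have "carry p (map (rpow k) [1 :: 'a poly]) = 0"
    using carry_Cons_0[of "[]" p 1] by (simp del: carry.simps)
  ultimately show ?case
    by (intro exI[of _ "[1]"]) (auto simp: monic_irreducible_not_dvd_1 simp del: carry.simps)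
next
  case (insert P F)
  then have P: "P \<in> monic_irreducibles" "P \<notin> F" by auto
  have "F \<subseteq> monic_irreducibles" using insert.prems by simp
  from insert.IH[OF this] obtain as where as1: "distinct as"
    and as2: "\<forall>a\<in>set as. lead_coeff a = 1 \<and> (\<forall>P\<in>monic_irreducibles. P dvd a \<longrightarrow> P \<in> F)"
    and as3: "\<forall>a. lead_coeff a = 1 \<and> degree a < N \<and> (\<forall>P\<in>monic_irreducibles. P dvd a \<longrightarrow> P \<in> F)
      \<longrightarrow> a \<in> set as"
    and as5: "carry p (map (rpow k) as) / (\<Sum>a\<leftarrow>as. rpow k a) ^ p
      = (\<Sum>P\<in>F. G p (rpow k P) - G p (rpow k P ^ N))"
    by (elim exE conjE) (rule that)
  have monic: "lead_coeff a = 1" if "a \<in> set as" for a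
    using bspec[OF as2 that] by (rule conjunct1)
  have divisors: "Q \<in> F" if "a \<in> set as" "Q \<in> monic_irreducibles" "Q dvd a" for a Q
    using bspec[OF conjunct2[OF bspec[OF as2 that(1)]] that(2)] that(3) by (rule mp)
  have mem: "a \<in> set as" if "lead_coeff a = 1" "degree a < N"
    "\<And>Q. Q \<in> monic_irreducibles \<Longrightarrow> Q dvd a \<Longrightarrow> Q \<in> F" for a
    by (rule as3[rule_format]) (intro conjI ballI impI that; assumption)
  note as = as1 monic divisors mem
  define Ps where "Ps = map ((^) P) [0..<N]"
  define bs where "bs = list_times Ps as"
  have set_bs: "set bs = (\<lambda>(x, y). x * y) ` (((^) P ` {0..<N}) \<times> set as)"
    by (simp add: bs_def Ps_def set_list_times)
  have not_dvd: "\<not> P dvd a" if "a \<in> set as" for a using as(3)[OF that P(1)] P(2) by blast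
  have distinct_bs: "distinct bs"
    unfolding bs_def using distinct_map_power[OF P(1)] as(1)
      inj_on_prime_power_mult[OF P(1) not_dvd, of "set as"]
    by (intro distinct_list_times) (simp_all add: Ps_def)
  have monic_bs: "lead_coeff b = 1" if "b \<in> set bs" for b
    using that as(2) P(1) by (auto simp: set_bs lead_coeff_mult lead_coeff_power monic_irreducibles_def)
  have divisors_bs: "Q \<in> insert P F" if b: "b \<in> set bs" and Q: "Q \<in> monic_irreducibles" "Q dvd b" for b Q
  proof -
    obtain i a where a: "a \<in> set as" "b = P ^ i * a" using b by (auto simp: set_bs)
    from monic_irreducible_dvd_mult[OF Q(1) Q(2)[unfolded a(2)]] show ?thesis
    proof
      assume "Q dvd P ^ i"
      from dvd_monic_irreducible_power_imp_eq[OF P(1) Q(1) this] show ?thesis by simp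
    next
      assume "Q dvd a"
      from divisors[OF a(1) Q(1) this] show ?thesis by simp
    qed
  qed
  have mem_bs: "a \<in> set bs" if a: "lead_coeff a = 1" "degree a < N"
    "\<And>Q. Q \<in> monic_irreducibles \<Longrightarrow> Q dvd a \<Longrightarrow> Q \<in> insert P F" for a
  proof -
    obtain i b where ib: "a = P ^ i * b" "\<not> P dvd b" "lead_coeff b = 1" "i + degree b \<le> degree a"
      using extract_prime_power[OF P(1) a(1)] by blast
    have "b \<in> set as"
    proof (rule as(4))
      fix Q assume "Q \<in> monic_irreducibles" "Q dvd b"
      then show "Q \<in> F" using a(3)[of Q] ib(1,2) by auto
    qed (use ib a in auto)
    then show ?thesis using ib a(2) by (auto simp: set_bs)
  qed
  have carry_bs: "carry p (map (rpow k) bs) / (\<Sum>a\<leftarrow>bs. rpow k a) ^ p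
      = (\<Sum>P\<in>insert P F. G p (rpow k P) - G p (rpow k P ^ N))"
  proof -
    define x where "x = rpow k P"
    define s where "s = (\<Sum>i\<leftarrow>[0..<N]. x ^ i)"
    define t where "t = (\<Sum>a\<leftarrow>as. rpow k a)"
    have "1 * 1 \<le> k * degree P" using k monic_irreducible_degree[OF P(1)] by (intro mult_le_mono) auto
    then have x: "small 1 x" unfolding x_def by (intro small_rpow) simp
    have map_bs: "map (rpow k) bs = list_times (map ((^) x) [0..<N]) (map (rpow k) as)"
      unfolding bs_def Ps_def by (subst map_list_times) (simp_all add: rpow_mult rpow_power x_def o_def)
    have "1 \<in> set as"
    proof (rule as(4))
      fix Q :: "'a poly" assume "Q \<in> monic_irreducibles" "Q dvd 1"
      then show "Q \<in> F" using monic_irreducible_not_dvd_1 by blast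
    qed (use N in auto)
    then have t0: "t \<noteq> 0"
      unfolding t_def using fls_unit_sum_rpow[OF k as(1)] as(2) fls_unit_nonzero by blast
    have s0: "s \<noteq> 0" and geo: "carry p (map ((^) x) [0..<N]) / s ^ p = G p x - G p (x ^ N)"
      unfolding s_def using carry_geometric_divide[OF p x N] by auto
    have "(\<Sum>y\<leftarrow>map ((^) x) [0..<N]. y ^ p) = s ^ p"
      using sum_list_power_char[of p "map ((^) x) [0..<N]"] p by (simp add: s_def)
    then have "carry p (map (rpow k) bs) = carry p (map ((^) x) [0..<N]) * t ^ p + s ^ p * carry p (map (rpow k) as)"
      unfolding map_bs carry_list_times[OF p(1)] by (simp add: t_def)
    moreover have "(\<Sum>a\<leftarrow>bs. rpow k a) = s * t"
      unfolding map_bs sum_list_list_times by (simp add: s_def t_def)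
    ultimately have "carry p (map (rpow k) bs) / (\<Sum>a\<leftarrow>bs. rpow k a) ^ p
        = carry p (map ((^) x) [0..<N]) / s ^ p + carry p (map (rpow k) as) / t ^ p"
      using s0 t0 by (simp add: field_simps)
    also have "\<dots> = (G p x - G p (x ^ N)) + (\<Sum>P\<in>F. G p (rpow k P) - G p (rpow k P ^ N))"
      unfolding geo t_def as5 ..
    finally show ?thesis using insert by (simp add: x_def)
  qed
  show ?case
  proof (intro exI[of _ bs] conjI ballI allI impI)
    fix a assume a: "lead_coeff a = 1 \<and> degree a < N
      \<and> (\<forall>Q\<in>monic_irreducibles. Q dvd a \<longrightarrow> Q \<in> insert P F)"
    show "a \<in> set bs"
      by (rule mem_bs[OF conjunct1[OF a] conjunct1[OF conjunct2[OF a]]])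
        (rule mp[OF bspec[OF conjunct2[OF conjunct2[OF a]]]])
  qed (fact distinct_bs, erule monic_bs, rule divisors_bs, assumption+, fact carry_bs)
qed

text \<open>The Euler product family contains every monic polynomial of degree below
  \<open>N\<close>, because all irreducible factors of such a polynomial lie in \<open>F\<close>.
  Its other members have degree at least \<open>N\<close>, so dropping them costs only valuation
  \<open>N\<close>; the boundary terms at \<open>rpow k P ^ N\<close> are equally small.\<close>

lemma sum_G_approx:
  fixes F :: "'a::field poly set"
  assumes p: "prime p" "CHAR('a) = p" and k: "k \<ge> 1" and N: "N \<ge> 1"
    and F: "finite F" "F \<subseteq> monic_irreducibles" "{P\<in>monic_irreducibles. degree P < N} \<subseteq> F"
  shows "\<exists>bs. distinct bs \<and> set bs = monics N \<and>
    small N ((\<Sum>P\<in>F. G p (rpow k P)) - carry p (map (rpow k) bs) / (\<Sum>b\<leftarrow>bs. rpow k b) ^ p)"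
proof -
  let ?x = "rpow k"
  obtain as where as1: "distinct as"
    and as2: "\<forall>a\<in>set as. lead_coeff a = 1 \<and> (\<forall>P\<in>monic_irreducibles. P dvd a \<longrightarrow> P \<in> F)"
    and as3: "\<forall>a. lead_coeff a = 1 \<and> degree a < N \<and> (\<forall>P\<in>monic_irreducibles. P dvd a \<longrightarrow> P \<in> F)
      \<longrightarrow> a \<in> set as"
    and as4: "carry p (map ?x as) / (\<Sum>a\<leftarrow>as. ?x a) ^ p = (\<Sum>P\<in>F. G p (?x P) - G p (?x P ^ N))"
    using euler_product_carry[OF p k N F(1,2)] by (elim exE conjE) (rule that)
  have monic: "lead_coeff a = 1" if "a \<in> set as" for a
    using bspec[OF as2 that] by (rule conjunct1)
  have mem: "a \<in> set as" if "lead_coeff a = 1" "degree a < N"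
    "\<And>Q. Q \<in> monic_irreducibles \<Longrightarrow> Q dvd a \<Longrightarrow> Q \<in> F" for a
    by (rule as3[rule_format]) (intro conjI ballI impI that; assumption)
  note as = as1 monic mem
  define bs where "bs = filter (\<lambda>a. degree a < N) as"
  define cs where "cs = filter (\<lambda>a. \<not> degree a < N) as"
  have set_bs: "set bs = monics N"
  proof (intro equalityI subsetI)
    fix a :: "'a poly" assume a: "a \<in> monics N"
    have "a \<in> set as"
    proof (rule as(3))
      fix Q assume Q: "Q \<in> monic_irreducibles" "Q dvd a"
      have "a \<noteq> 0" using a by (auto simp: monics_def)
      with Q have "degree Q \<le> degree a" by (intro dvd_imp_degree_le)
      with Q a F(3) show "Q \<in> F" by (auto simp: monics_def)
    qed (use a in \<open>auto simp: monics_def\<close>)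
    with a show "a \<in> set bs" by (auto simp: monics_def bs_def)
  qed (use as in \<open>auto simp: monics_def bs_def\<close>)
  have dist_bs: "distinct bs" using as(1) by (simp add: bs_def)
  have mset: "mset as = mset (cs @ bs)" by (simp add: bs_def cs_def)
  have one: "1 \<in> monics N" using N by (simp add: monics_def)
  have units: "fls_unit (\<Sum>a\<leftarrow>as. ?x a)" "fls_unit (\<Sum>a\<leftarrow>bs. ?x a)"
    using one set_bs as(2) by (intro fls_unit_sum_rpow k as(1) dist_bs; auto simp: bs_def)+
  have carry_eq: "carry p (map ?x as) = carry p (map ?x cs @ map ?x bs)"
    using mset by (intro carry_perm p) simp
  have sum_eq: "(\<Sum>a\<leftarrow>as. ?x a) = (\<Sum>a\<leftarrow>cs. ?x a) + (\<Sum>a\<leftarrow>bs. ?x a)"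
  proof -
    have "(\<Sum>a\<leftarrow>as. ?x a) = (\<Sum>a\<leftarrow>cs @ bs. ?x a)" using mset by (metis mset_map sum_mset_sum_list)
    then show ?thesis by simp
  qed
  have N_le: "N \<le> k * degree a" if "N \<le> degree a" for a :: "'a poly"
    using that k by (metis mult_le_mono nat_mult_1)
  have small_cs: "small N (?x a)" if "a \<in> set cs" for a
    using that by (intro small_rpow N_le) (auto simp: cs_def)
  have small_0: "small 0 (?x a)" for a by (rule small_rpow) simp
  have "small N (carry p (map ?x as) / (\<Sum>a\<leftarrow>as. ?x a) ^ p - carry p (map ?x bs) / (\<Sum>a\<leftarrow>bs. ?x a) ^ p)"
  proof (rule small_divide_diff)
    show "small N (carry p (map ?x as) - carry p (map ?x bs))"
      unfolding carry_eq by (rule small_carry_append) (auto intro: small_cs small_0)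
    show "small N ((\<Sum>a\<leftarrow>as. ?x a) ^ p - (\<Sum>a\<leftarrow>bs. ?x a) ^ p)"
      by (rule small_power_diff) (auto simp: sum_eq intro!: small_add small_sum_list small_cs small_0)
    show "small 0 (carry p (map ?x bs))" by (rule small_carry) (auto intro: small_0)
  qed (intro fls_unit_power units)+
  moreover have "small N (\<Sum>P\<in>F. G p (?x P ^ N))"
  proof (intro small_sum small_G p(1) N)
    fix P assume "P \<in> F"
    then have "1 * 1 \<le> k * degree P"
      using F(2) k monic_irreducible_degree by (intro mult_le_mono) (auto simp: Suc_le_eq)
    then have "small 1 (?x P)" by (intro small_rpow) simp
    then show "small N (?x P ^ N)" using small_power[of 1 "?x P" N] by simp
  qed
  ultimately have "small N ((\<Sum>P\<in>F. G p (?x P)) - carry p (map ?x bs) / (\<Sum>a\<leftarrow>bs. ?x a) ^ p)"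
    unfolding as4 sum_subtractf using small_add by fastforce
  with dist_bs set_bs show ?thesis by blast
qed

section \<open>The two ranges of exponents\<close>

lemma witt_factor_0 [simp]: "witt_factor 0 j = 1"
  by (simp add: witt_factor_def)

text \<open>The Witt coordinates of \<open>1 - a X + c X\<^sup>q\<^sup>+\<^sup>1\<close> up to degree \<open>2 q\<close>.\<close>

definition two_term_coords :: "nat \<Rightarrow> 'r::comm_ring_1 \<Rightarrow> 'r \<Rightarrow> nat \<Rightarrow> 'r" where
  "two_term_coords q a c j = (if j = 1 then a else if j \<le> q then 0 else - c * a ^ (j - q - 1))"

lemma witt_prod_two_term_coords_low:
  assumes "1 \<le> M" "M \<le> q"
  shows "witt_prod (two_term_coords q a c) M = witt_factor a 1"
  using assms
proof (induction M rule: dec_induct)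
  case base
  then show ?case by (simp add: witt_prod_def two_term_coords_def)
next
  case (step M)
  then show ?case by (simp add: witt_prod_Suc two_term_coords_def)
qed

text \<open>Up to degree \<open>2 q\<close>, the partial product is
  \<open>1 - a X + c X^(q+1)\<close> with the single error term \<open>- c a^(M-q) X^(M+1)\<close>.
  The next factor cancels this error, and its product with \<open>- a X\<close> creates the next
  one; all further cross terms exceed degree \<open>2 q\<close>.\<close>

lemma witt_prod_two_term_coords_high:
  assumes "2 \<le> q" "q \<le> M" "i \<le> 2 * q"
  shows "witt_prod (two_term_coords q a c) M $ i =
    (if i = 0 then 1 else 0) - (if i = 1 then a else 0) + (if i = q + 1 then c else 0)
      - (if i = M + 1 then c * a ^ (M - q) else 0)"
  using assms(2,3)
proof (induction M arbitrary: i rule: dec_induct)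
  case base
  have "witt_prod (two_term_coords q a c) q = witt_factor a 1"
    using assms(1) by (intro witt_prod_two_term_coords_low) auto
  then show ?case by (simp add: fps_nth_witt_factor)
next
  case (step M)
  have b: "two_term_coords q a c (Suc M) = - c * a ^ (M - q)"
    using step.hyps assms(1) by (simp add: two_term_coords_def)
  consider "i \<le> M" | "i = M + 1" | "i = M + 2" | "i > M + 2" by linarith
  then show ?case
  proof cases
    case 1
    then show ?thesis using step by (simp add: witt_prod_Suc fps_nth_mult_witt_factor)
  next
    case 2
    then show ?thesis using step assms(1)
      by (simp add: witt_prod_Suc fps_nth_mult_witt_factor b)
  next
    case 3
    then have "i - Suc M = 1" by simp
    then show ?thesis using step.IH[of i] step.IH[of 1] step.prems step.hyps assms(1) 3
      by (simp add: witt_prod_Suc fps_nth_mult_witt_factor b Suc_diff_le)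
  next
    case 4
    then have "i - Suc M \<noteq> 0" "i - Suc M \<noteq> 1" "i - Suc M \<noteq> q + 1" "i - Suc M \<noteq> M + 1" "i - Suc M \<le> 2 * q"
      using step.hyps step.prems by auto
    then have "witt_prod (two_term_coords q a c) M $ (i - Suc M) = 0"
      using step.IH[of "i - Suc M"] by simp
    then show ?thesis using step.IH[of i] step.prems step.hyps assms(1) 4
      by (simp add: witt_prod_Suc fps_nth_mult_witt_factor)
  qed
qed

text \<open>The entries for \<open>j \<ge> 2\<close> are positive powers of \<open>0\<close>, so the
  list is a single entry followed by zeros.\<close>

lemma carry_witt_carry_list_eq_0:
  assumes "l > 0" "\<And>j. 2 \<le> j \<Longrightarrow> j \<le> l \<Longrightarrow> a j = 0"
  shows "carry p (witt_carry_list l a) = 0" "sum_list (witt_carry_list l a) = a 1 ^ l"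
proof -
  let ?xs = "concat (map (\<lambda>j. replicate j (a j ^ (l div j))) (filter (\<lambda>j. j dvd l) [2..<Suc l]))"
  have "[1..<Suc l] = 1 # [2..<Suc l]"
    using assms(1) by (simp add: upt_rec numeral_2_eq_2)
  then have *: "witt_carry_list l a = a 1 ^ l # ?xs"
    unfolding witt_carry_list_def by simp
  have 0: "set ?xs \<subseteq> {0}"
    using assms by (auto simp: power_0_left div_eq_0_iff dest: dvd_imp_le)
  show "carry p (witt_carry_list l a) = 0" unfolding * by (rule carry_Cons_0[OF 0])
  have "sum_list ys = 0" if "set ys \<subseteq> {0}" for ys :: "'a list"
    using that by (induction ys) auto
  from this[OF 0] show "sum_list (witt_carry_list l a) = a 1 ^ l" unfolding * by simp
qed

lemma coeff_prod_linear_1: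
  "coeff (\<Prod>a\<in>A. [:1, - f a:]) 1 = - (\<Sum>a\<in>A. f a :: 'r::comm_ring_1) \<and> coeff (\<Prod>a\<in>A. [:1, - f a:]) 0 = 1"
  by (induction A rule: infinite_finite_induct) (auto simp: coeff_pCons one_pCons algebra_simps)

section \<open>Evaluation of the carry quotients and passage to the limit\<close>

context finite_field_order
begin

lemma char_fps_Y:
  assumes "distinct bs" "set bs = monics D"
  shows "char_fps (map Y bs) = fps_of_poly (F D)"
proof -
  have lin: "witt_factor y 1 = fps_of_poly [:1, - y:]" for y :: "'a fls"
    by (rule fps_ext) (auto simp: fps_nth_witt_factor coeff_pCons split: nat.splits)
  have "char_fps (map Y bs) = prod_list (map (\<lambda>b. fps_of_poly [:1, - Y b:]) bs)"
    unfolding char_fps_def map_map o_def lin ..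
  also have "\<dots> = (\<Prod>b\<in>monics D. fps_of_poly [:1, - Y b:])"
    using prod.distinct_set_conv_list[OF assms(1)] assms(2) by metis
  finally show ?thesis by (simp only: F_def fps_of_poly_prod)
qed

lemma coeff_F_1_eq: "coeff (F D) 1 = - (\<Sum>a\<in>monics D. Y a)"
  using coeff_prod_linear_1[of Y "monics D"] by (simp add: F_def)

lemma Y_eq_rpow: "Y a = rpow (q - 1) a"
  by (simp add: Y_def rpow_def power_divide)

lemma rpow_eq_Y_power: "rpow ((q - 1) * l) a = Y a ^ l"
  by (simp add: Y_eq_rpow rpow_def power_divide power_mult)

lemma minus_power_q: "(- x :: 'a fls) ^ q = - (x ^ q)"
  using frobenius_add_fls[of x "- x" 1] q_gt_1 by (simp add: eq_neg_iff_add_eq_0 add.commute power_0_left)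

lemma diff_power_q: "(x - y :: 'a fls) ^ q = x ^ q - y ^ q"
  using frobenius_add_fls[of x "- y" 1] by (simp add: minus_power_q)

lemma map_rpow_eq: "map (rpow ((q - 1) * l)) bs = map (\<lambda>y. y ^ l) (map Y bs)"
  unfolding map_map by (rule map_cong[OF refl]) (simp only: o_apply rpow_eq_Y_power)

text \<open>Up to degree \<open>q\<close> the series is \<open>1 + c1 X\<close>, so all Witt
  coordinates beyond the first vanish. The first does not enter the correction sum, since
  \<open>1\<close> divides \<open>l\<close>.\<close>

lemma carry_low:
  fixes bs :: "'a poly list"
  assumes bs: "distinct bs" "set bs = monics D" and l: "l \<ge> 1" "l * p \<le> q"
  shows "carry p (map (rpow ((q - 1) * l)) bs) = 0"
proof -
  have p: "p \<ge> 2" using prime_p by (rule prime_ge_2_nat)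
  define a where "a = two_term_coords q (- coeff (F D) 1) 0"
  have a0: "a j = 0" if "2 \<le> j" for j
    using that by (simp add: a_def two_term_coords_def)
  have "l \<le> l * p" using p by simp
  have "witt_prod a (l * p) $ i = char_fps (map Y bs) $ i" if "i \<le> l * p" for i
  proof -
    have "witt_prod a (l * p) = witt_factor (- coeff (F D) 1) 1"
      unfolding a_def using l p by (intro witt_prod_two_term_coords_low) auto
    then show ?thesis using that l coeff_F_small[of i D]
      by (auto simp: char_fps_Y[OF bs] fps_nth_witt_factor)
  qed
  then have "carry p (map (\<lambda>y. y ^ l) (map Y bs)) = carry p (witt_carry_list l a)
     - (\<Sum>j | j dvd l * p \<and> \<not> j dvd l. of_nat (j div p) * a j ^ (l * p div j))"
    using l by (intro carry_map_power prime_p) auto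
  also have "carry p (witt_carry_list l a) = 0"
    using l a0 by (intro carry_witt_carry_list_eq_0) auto
  also have "(\<Sum>j | j dvd l * p \<and> \<not> j dvd l. of_nat (j div p) * a j ^ (l * p div j)) = 0"
  proof (rule sum.neutral, clarify)
    fix j assume j: "j dvd l * p" "\<not> j dvd l"
    have "0 < l * p" using l p by simp
    note divisor_bounds[OF this j(1)]
    moreover from j have "j \<noteq> 1" by auto
    ultimately have "a j = 0" "l * p div j > 0" by (auto intro: a0 simp: div_greater_zero_iff)
    then show "of_nat (j div p) * a j ^ (l * p div j) = 0" by simp
  qed
  finally show ?thesis unfolding map_rpow_eq by simp
qed

text \<open>Since \<open>l \<le> q\<close>, the carry of the Witt list vanishes and the
  \<open>l\<close>-th power sum is \<open>(- c1)^l\<close>. In the correction sum every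
  \<open>j\<close> other than \<open>l * p\<close> satisfies \<open>2 \<le> j\<close> and
  \<open>2 * j \<le> l * p\<close>, so \<open>j \<le> q\<close> and its coordinate vanishes. The
  term \<open>j = l * p\<close> has weight \<open>l\<close>, and its coordinate contains
  \<open>c2\<close>.\<close>

lemma carry_high:
  fixes bs :: "'a poly list"
  assumes bs: "distinct bs" "set bs = monics D" and D: "D \<ge> 1" and l: "q + 1 \<le> l * p" "l * p \<le> 2 * q"
  shows "carry p (map (rpow ((q - 1) * l)) bs) / (\<Sum>b\<leftarrow>bs. rpow ((q - 1) * l) b) ^ p
    = of_nat l * (coeff (F D) (q + 1) / coeff (F D) 1 ^ (q + 1))"
proof -
  let ?M = "l * p"
  define c1 where "c1 = coeff (F D) 1"
  define c2 where "c2 = coeff (F D) (q + 1)"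
  define a where "a = two_term_coords q (- c1) c2"
  have p: "p \<ge> 2" using prime_p by (rule prime_ge_2_nat)
  have l0: "l > 0" using l by (cases l) auto
  have "l * 2 \<le> l * p" using p by (intro mult_le_mono2)
  then have lq: "l \<le> q" and l_less: "l < ?M" using l l0 by linarith+
  have a0: "a j = 0" if "2 \<le> j" "j \<le> q" for j
    using that by (simp add: a_def two_term_coords_def)
  have witt: "witt_prod a ?M $ i = char_fps (map Y bs) $ i" if i: "i \<le> ?M" for i
  proof -
    have "witt_prod a ?M $ i =
      (if i = 0 then 1 else 0) - (if i = 1 then - c1 else 0) + (if i = q + 1 then c2 else 0)"
      unfolding a_def using i l q_gt_1 by (subst witt_prod_two_term_coords_high) auto
    moreover consider "i = 0" | "i = 1" | "i = q + 1" | "2 \<le> i" "i \<noteq> q + 1" by linarith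
    then have "coeff (F D) i =
      (if i = 0 then 1 else 0) - (if i = 1 then - c1 else 0) + (if i = q + 1 then c2 else 0)"
    proof cases
      case 4
      then show ?thesis using coeff_F_small[of i D] i l by simp
    qed (use q_gt_1 in \<open>auto simp: c1_def c2_def\<close>)
    ultimately show ?thesis by (simp add: char_fps_Y[OF bs])
  qed
  have low: "carry p (witt_carry_list l a) = 0" "sum_list (witt_carry_list l a) = (- c1) ^ l"
    using carry_witt_carry_list_eq_0[OF l0, of a] a0 lq by (auto simp: a_def two_term_coords_def)
  have "(\<Sum>j | j dvd ?M \<and> \<not> j dvd l. of_nat (j div p) * a j ^ (?M div j))
      = (\<Sum>j\<in>{?M}. of_nat (j div p) * a j ^ (?M div j))"
  proof (rule sum.mono_neutral_right)
    have "?M > 0" using l by linarith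
    then show "finite {j. j dvd ?M \<and> \<not> j dvd l}" by simp
    show "{?M} \<subseteq> {j. j dvd ?M \<and> \<not> j dvd l}" using l0 l_less by (auto dest: dvd_imp_le)
    show "\<forall>j\<in>{j. j dvd ?M \<and> \<not> j dvd l} - {?M}. of_nat (j div p) * a j ^ (?M div j) = 0"
    proof
      fix j assume j: "j \<in> {j. j dvd ?M \<and> \<not> j dvd l} - {?M}"
      then obtain d where d: "?M = j * d" by blast
      with \<open>?M > 0\<close> have "d > 0" "j > 0" by (auto intro!: gr0I)
      moreover have "d \<noteq> 1" using d j by auto
      ultimately have "j * 2 \<le> ?M" unfolding d by (intro mult_le_mono2) linarith
      then have "j \<le> q" using l by linarith
      moreover have "j \<noteq> 1" using j by auto
      ultimately have "a j = 0" using \<open>j > 0\<close> by (intro a0) linarith+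
      moreover have "?M div j > 0" using d \<open>d > 0\<close> \<open>j > 0\<close> by simp
      ultimately show "of_nat (j div p) * a j ^ (?M div j) = 0" by simp
    qed
  qed
  also have "\<dots> = of_nat l * a ?M" using p l by simp
  also have "a ?M = - c2 * (- c1) ^ (?M - q - 1)"
  proof -
    have "?M \<noteq> 1" "\<not> ?M \<le> q" using l q_gt_1 by linarith+
    then show ?thesis unfolding a_def two_term_coords_def by (simp only: if_False)
  qed
  finally have "carry p (map (\<lambda>y. y ^ l) (map Y bs)) = of_nat l * (c2 * (- c1) ^ (?M - q - 1))"
    using carry_map_power[OF prime_p l0 witt] low by simp
  then have carry: "carry p (map (rpow ((q - 1) * l)) bs) = of_nat l * (c2 * (- c1) ^ (?M - q - 1))"
    unfolding map_rpow_eq .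
  have "(\<Sum>y\<leftarrow>map Y bs. y ^ l) = sum_list (witt_carry_list l a)"
    using power_sum_eq_witt_ghost[OF witt l0] l_less sum_list_witt_carry_list[OF l0, of "\<lambda>x. x" a] by simp
  then have sum: "(\<Sum>b\<leftarrow>bs. rpow ((q - 1) * l) b) ^ p = (- c1) ^ ?M"
    unfolding map_rpow_eq low by (simp only: power_mult)
  have "(- c1) ^ ?M = (- c1) ^ (?M - q - 1) * (- c1) ^ (q + 1)"
  proof -
    have "?M = (?M - q - 1) + (q + 1)" using l by linarith
    then have "(- c1) ^ ?M = (- c1) ^ ((?M - q - 1) + (q + 1))" by (rule arg_cong)
    then show ?thesis by (simp only: power_add)
  qed
  moreover have "(- c1) ^ (q + 1) = c1 ^ (q + 1)" using minus_power_q[of c1] by simp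
  ultimately have sum': "(- c1) ^ ?M = (- c1) ^ (?M - q - 1) * c1 ^ (q + 1)"
    by (simp only:)
  show ?thesis
  \<comment> \<open>For \<open>c1 = 0\<close> both sides are quotients by \<open>0\<close>, hence
    \<open>0\<close> by convention.\<close>
  proof (cases "c1 = 0")
    case True
    then show ?thesis using l0 p unfolding carry sum c1_def[symmetric] c2_def[symmetric] by simp
  next
    case False
    then show ?thesis unfolding carry sum sum' c1_def[symmetric] c2_def[symmetric] by simp
  qed
qed

definition limit_ratio :: "'a fls" where
  "limit_ratio = (T_fls ^ q - T_fls) ^ (q + 1) / ((T_fls ^ (q ^ 2) - T_fls ^ q) * (T_fls ^ (q ^ 2) - T_fls))"

lemma T_diff_subdegree:
  assumes "b < a"
  shows "fls_subdegree (T_fls ^ a - T_fls ^ b :: 'a fls) = - int a" "(T_fls ^ a - T_fls ^ b :: 'a fls) \<noteq> 0"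
proof -
  show deg: "fls_subdegree (T_fls ^ a - T_fls ^ b :: 'a fls) = - int a"
    using assms by (subst fls_subdegree_diff_eq1) auto
  show "(T_fls ^ a - T_fls ^ b :: 'a fls) \<noteq> 0"
  proof
    assume *: "(T_fls ^ a - T_fls ^ b :: 'a fls) = 0"
    show False using deg assms unfolding * by simp
  qed
qed

text \<open>Dividing \<open>coeff_F_relation\<close> by \<open>c1^(q+1)\<close> leaves
  \<open>A / C\<close> plus the error \<open>(g / c1) * (B / C)\<close>. Here \<open>g\<close> is
  the sum of \<open>Y a\<close> over monic \<open>a\<close> of degree exactly \<open>D\<close>,
  hence small, while \<open>c1\<close> is a unit and \<open>B / C\<close> has valuation
  \<open>0\<close>.\<close>

lemma limit_ratio_approx:
  assumes D: "D \<ge> 1"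
  shows "small D (coeff (F D) (q + 1) / coeff (F D) 1 ^ (q + 1) - limit_ratio)"
proof -
  let ?T = "T_fls :: 'a fls"
  define c1 where "c1 = coeff (F D) 1"
  define g where "g = c1 - coeff (F (Suc D)) 1"
  define A where "A = ?T ^ q - ?T"
  define B where "B = ?T ^ (q ^ 2) - ?T ^ q"
  define C where "C = ?T ^ (q ^ 2) - ?T"
  have q2: "q < q ^ 2" using q_gt_1 by (simp add: power2_eq_square)
  \<comment> \<open>By Frobenius, \<open>q\<close> of the \<open>q + 1\<close> factors in the
    numerator of \<open>limit_ratio\<close> cancel against \<open>B\<close>.\<close>
  have AB: "A ^ q = B"
    by (simp add: A_def B_def diff_power_q power2_eq_square flip: power_mult)
  have B0: "B \<noteq> 0" "fls_subdegree B = - int (q ^ 2)"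
    unfolding B_def using T_diff_subdegree[OF q2] by auto
  have C0: "C \<noteq> 0" "fls_subdegree C = - int (q ^ 2)"
    unfolding C_def using T_diff_subdegree[of 1 "q ^ 2"] q_gt_1 q2 by auto
  have lim: "limit_ratio = A / C"
    using B0 by (simp add: limit_ratio_def A_def[symmetric] B_def[symmetric] C_def[symmetric] AB)
  have Y: "small D (Y a)" if "degree a \<ge> D" for a
  proof -
    have "1 * D \<le> (q - 1) * degree a" using that q_gt_1 by (intro mult_le_mono) auto
    then show ?thesis unfolding Y_eq_rpow by (intro small_rpow) simp
  qed
  have unit: "fls_unit c1"
  proof -
    obtain bs where bs: "set bs = (monics D :: 'a poly set)" "distinct bs"
      using finite_distinct_list[OF finite_monics] by blast
    have "1 \<in> set bs" unfolding bs using D by (simp add: monics_def)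
    then have "fls_unit (\<Sum>b\<leftarrow>bs. rpow (q - 1) b)"
      using bs q_gt_1 by (intro fls_unit_sum_rpow) (auto simp: monics_def)
    then show ?thesis
      using bs unfolding c1_def coeff_F_1_eq
      by (simp add: fls_unit_uminus Y_eq_rpow sum_list_distinct_conv_sum_set)
  qed
  have "g = (\<Sum>a\<in>monics (Suc D) - monics D. Y a)"
  proof -
    have "monics D \<subseteq> (monics (Suc D) :: 'a poly set)" by (auto simp: monics_def)
    then show ?thesis by (simp add: g_def c1_def coeff_F_1_eq sum_diff del: One_nat_def)
  qed
  then have g: "small D g" by (auto intro!: small_sum Y simp: monics_def)
  have "C * coeff (F D) (q + 1) = c1 ^ q * (A * c1 + g * B)"
    using coeff_F_relation[of D] by (simp only: A_def B_def C_def c1_def g_def)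
  then have "coeff (F D) (q + 1) = c1 ^ q * (A * c1 + g * B) / C"
    using C0 by (simp add: field_simps)
  then have "coeff (F D) (q + 1) / c1 ^ (q + 1) = A / C + (g / c1) * (B / C)"
    using fls_unit_nonzero[OF unit] C0 by (simp add: field_simps)
  moreover have "small 0 (B / C)"
    using B0 C0 by (simp add: small_def divide_inverse)
  then have "small D ((g / c1) * (B / C))"
    by (rule small_mult_right[OF small_divide[OF g unit]])
  ultimately show ?thesis by (simp add: lim c1_def)
qed

text \<open>As soon as a finite set of primes contains all those of degree below \<open>N\<close>,
  \<open>sum_G_approx\<close> compares its sum with the carry quotient of the monic polynomials of
  degree below \<open>N\<close>, and the hypothesis compares the latter with
  \<open>v\<close>.\<close>

lemma has_sum_of_approx:
  fixes v :: "'a fls"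
  assumes k: "k \<ge> 1"
    and approx: "\<And>N bs. N \<ge> 1 \<Longrightarrow> distinct bs \<Longrightarrow> set bs = (monics N :: 'a poly set) \<Longrightarrow>
      small N (carry p (map (rpow k) bs) / (\<Sum>b\<leftarrow>bs. rpow k b) ^ p - v)"
  shows "((\<lambda>P. G p (rpow k P)) has_sum v) monic_irreducibles"
  unfolding has_sum_def tendsto_iff
proof (intro allI impI)
  fix e :: real assume "e > 0"
  obtain N where N: "inverse (2 ^ N) < e" "N \<ge> 1"
  proof -
    obtain n where n: "inverse (2 ^ n) < e"
      using real_arch_pow_inv[OF \<open>e > 0\<close>, of "1 / 2"] by (auto simp: power_one_over inverse_eq_divide)
    have "inverse (2 ^ Suc n) \<le> (inverse (2 ^ n) :: real)" by simp
    with n have "inverse (2 ^ Suc n) < e" by linarith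
    then show ?thesis by (rule that) simp
  qed
  let ?F = "{P\<in>monic_irreducibles. degree P < N} :: 'a poly set"
  have fin: "finite ?F"
    by (rule finite_subset[OF _ finite_monics[of N]]) (auto simp: monics_def monic_irreducibles_def)
  show "\<forall>\<^sub>F F in finite_subsets_at_top monic_irreducibles. dist (\<Sum>P\<in>F. G p (rpow k P)) v < e"
    unfolding eventually_finite_subsets_at_top
  proof (intro exI[of _ ?F] conjI allI impI)
    fix F :: "'a poly set" assume F: "finite F \<and> ?F \<subseteq> F \<and> F \<subseteq> monic_irreducibles"
    then obtain bs where bs: "distinct bs" "set bs = monics N"
      "small N ((\<Sum>P\<in>F. G p (rpow k P)) - carry p (map (rpow k) bs) / (\<Sum>b\<leftarrow>bs. rpow k b) ^ p)"
      using sum_G_approx[OF prime_p char_eq k N(2), of F] by blast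
    from small_add[OF bs(3) approx[OF N(2) bs(1,2)]]
    have "small N ((\<Sum>P\<in>F. G p (rpow k P)) - v)" by simp
    then show "dist (\<Sum>P\<in>F. G p (rpow k P)) v < e"
      using dist_fls_le_of_small N(1) by (meson le_less_trans)
  qed (use fin in auto)
qed

lemma has_sum_low:
  assumes "l \<ge> 1" "l * p \<le> q"
  shows "((\<lambda>P. G p (rpow ((q - 1) * l) P)) has_sum (0 :: 'a fls)) monic_irreducibles"
proof (rule has_sum_of_approx)
  show "1 \<le> (q - 1) * l" using assms q_gt_1 by (cases l) auto
qed (simp only: carry_low[OF _ _ assms], simp)

lemma has_sum_high:
  assumes "q + 1 \<le> l * p" "l * p \<le> 2 * q"
  shows "((\<lambda>P. G p (rpow ((q - 1) * l) P)) has_sum (of_nat l * limit_ratio)) monic_irreducibles"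
proof (rule has_sum_of_approx)
  show "1 \<le> (q - 1) * l" using assms q_gt_1 by (cases l) auto
  fix N bs assume *: "N \<ge> 1" "distinct bs" "set bs = (monics N :: 'a poly set)"
  have "small N (of_nat l * (coeff (F N) (q + 1) / coeff (F N) 1 ^ (q + 1) - limit_ratio))"
    by (intro small_mult_left small_of_nat limit_ratio_approx *)
  then show "small N (carry p (map (rpow ((q - 1) * l)) bs) / (\<Sum>b\<leftarrow>bs. rpow ((q - 1) * l) b) ^ p
      - of_nat l * limit_ratio)"
    unfolding carry_high[OF *(2,3,1) assms] by (simp only: right_diff_distrib)
qed

end

theorem theorem1p7:
  fixes p q n l k :: nat
  assumes "prime p"
    and "n \<ge> 1" and "q = p ^ n"
    and "CARD('a::{field,finite}) = q"
    and "l \<ge> 1" and "k = (q - 1) * l"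
  shows "(real l \<le> real q / real p \<longrightarrow>
            ((\<lambda>P. G p (1 / poly_to_fls P ^ k)) has_sum (0 :: 'a fls)) monic_irreducibles)
       \<and> (real q / real p + 1 < real l \<and> real l \<le> 2 * real q / real p \<longrightarrow>
            ((\<lambda>P. G p (1 / poly_to_fls P ^ k)) has_sum
               (of_nat l * ((T_fls ^ q - T_fls) ^ (q + 1) /
                  ((T_fls ^ (q ^ 2) - T_fls ^ q) * (T_fls ^ (q ^ 2) - T_fls))) :: 'a fls))
              monic_irreducibles)"
proof -
  interpret finite_field_order "TYPE('a)" p n q
    using assms by unfold_locales
  have p: "real p > 0" using prime_gt_0_nat[OF assms(1)] by simp
  have low: "l * p \<le> q" if "real l \<le> real q / real p"
  proof -
    from that p have "real l * real p \<le> real q" by (simp add: field_simps)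
    then show ?thesis by (metis of_nat_le_iff of_nat_mult)
  qed
  \<comment> \<open>Clearing the denominator turns the strict bound into
    \<open>q + p < l * p\<close>, which puts \<open>l * p\<close> above \<open>q\<close> as
    \<open>carry_high\<close> requires.\<close>
  have high: "q + 1 \<le> l * p \<and> l * p \<le> 2 * q"
    if "real q / real p + 1 < real l" "real l \<le> 2 * real q / real p"
  proof -
    from that p have "real q + real p < real l * real p" "real l * real p \<le> 2 * real q"
      by (simp_all add: field_simps)
    then have "real (q + p) < real (l * p)" "real (l * p) \<le> real (2 * q)" by simp_all
    then show ?thesis unfolding of_nat_le_iff of_nat_less_iff by linarith
  qed
  show ?thesis
    using has_sum_low[of l] has_sum_high[of l] low high assms(5,6)
    unfolding rpow_def limit_ratio_def by blast
qed

end
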